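(* Let $c>0$, and let $\varepsilon>0$ and $A>0$ be fixed constants. (a) If $\alpha\in[1/2,\infty)\setminus\mathbb{N}$ and $\mathbf{y}=(y_j)_{j\in\mathbb{Z}}$ satisfies $|y_j|\le A\big(1+|j|^{\lfloor 2\alpha+1\rfloor-1-\varepsilon}\big)$ for all $j\in\mathbb{Z}$, then the function $$\mathscr{I}_{\alpha,c}\mathbf{y}(x):=\sum_{j\in\mathbb{Z}}y_jL_{\alpha,c}(x-j)$$ is well-defined, continuous on $\mathbb{R}$, and satisfies $\mathscr{I}_{\alpha,c}\mathbf{y}(x)=O\big(1+|x|^{\lfloor 2\alpha+1\rfloor-1-\varepsilon}\big)$ as $|x|\to\infty$. (b) If $\alpha\in(-\infty,-3/2)$ and $|y_j|\le A\big(1+|j|^{\lceil 2|\alpha|-2\rceil-1-\varepsilon}\big)$ for all $j\in\mathbb{Z}$, then $\mathscr{I}_{\alpha,c}\mathbf{y}$, defined by the same series, is well-defined, continuous on $\mathbb{R}$, and satisfies $\mathscr{I}_{\alpha,c}\mathbf{y}(x)=O\big(1+|x|^{\lceil 2|\alpha|-2\rceil-1-\varepsilon}\big)$ as $|x|\to\infty$.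
   Context: For $c>0$ and $\alpha\in\mathbb{R}\setminus\{0,1,2,\dots\}$, the one-dimensional general multiquadric $\phi_{\alpha,c}(x)=(x^2+c^2)^\alpha$ has generalized Fourier transform $$\widehat{\phi}_{\alpha,c}(\xi)=\frac{2^{1+\alpha}}{\Gamma(-\alpha)}\Big(\frac{c}{|\xi|}\Big)^{\alpha+\frac12}K_{\alpha+\frac12}(c|\xi|),\quad \xi\neq 0,$$ where $K_\nu=K_{-\nu}$ is the modified Bessel function of the second kind. Set $$\widehat{L}_{\alpha,c}(\xi)=\frac{\widehat{\phi}_{\alpha,c}(\xi)}{\sum_{j\in\mathbb{Z}}\widehat{\phi}_{\alpha,c}(\xi+2\pi j)},\quad\xi\in\mathbb{R}$$ (extended by continuity to $\xi\in2\pi\mathbb{Z}$). This is in $L_1(\mathbb{R})$, and the fundamental function is $L_{\alpha,c}(x)=\frac1{2\pi}\int_{\mathbb{R}}\widehat{L}_{\alpha,c}(\xi)e^{ix\xi}d\xi$. *)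

theory Defs
  imports "HOL-Analysis.Analysis" "HOL-Library.Landau_Symbols"
begin

text \<open>
  Modified Bessel function of the second kind, by its integral representation, which is valid
  for every real order \<open>\<nu>\<close> and every \<open>x > 0\<close>.
\<close>

definition bessel_K :: "real \<Rightarrow> real \<Rightarrow> real" where
  "bessel_K \<nu> x = (LINT t:{0..}|lborel. exp (- x * cosh t) * cosh (\<nu> * t))"

text \<open>
  Generalized Fourier transform of the general multiquadric \<open>x \<mapsto> (x\<^sup>2 + c\<^sup>2) powr \<alpha>\<close>,
  for \<open>\<alpha>\<close> not a natural number; meaningful only for \<open>\<xi> \<noteq> 0\<close>.
\<close>

definition phi_hat :: "real \<Rightarrow> real \<Rightarrow> real \<Rightarrow> real" where
  "phi_hat \<alpha> c \<xi> =
     2 powr (1 + \<alpha>) / Gamma (- \<alpha>) * (c / \<bar>\<xi>\<bar>) powr (\<alpha> + 1/2) * bessel_K (\<alpha> + 1/2) (c * \<bar>\<xi>\<bar>)"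

definition L_hat_quot :: "real \<Rightarrow> real \<Rightarrow> real \<Rightarrow> real" where
  "L_hat_quot \<alpha> c \<xi> =
     phi_hat \<alpha> c \<xi> / (\<Sum>\<^sub>\<infinity>j\<in>(UNIV :: int set). phi_hat \<alpha> c (\<xi> + 2 * pi * of_int j))"

text \<open>
  At a multiple of \<open>2 * pi\<close> one of the terms above is evaluated at 0, so the value there is the
  limit along the punctured neighbourhood.
\<close>

definition L_hat :: "real \<Rightarrow> real \<Rightarrow> real \<Rightarrow> real" where
  "L_hat \<alpha> c \<xi> =
     (if \<exists>k::int. \<xi> = 2 * pi * of_int k then Lim (at \<xi>) (L_hat_quot \<alpha> c) else L_hat_quot \<alpha> c \<xi>)"

definition L_fund :: "real \<Rightarrow> real \<Rightarrow> real \<Rightarrow> complex" where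
  "L_fund \<alpha> c x =
     1 / (2 * pi) * (LINT \<xi>|lborel. of_real (L_hat \<alpha> c \<xi>) * exp (\<i> * of_real x * of_real \<xi>))"

definition interpolant :: "real \<Rightarrow> real \<Rightarrow> (int \<Rightarrow> complex) \<Rightarrow> real \<Rightarrow> complex" where
  "interpolant \<alpha> c y x = (\<Sum>\<^sub>\<infinity>j\<in>UNIV. y j * L_fund \<alpha> c (x - of_int j))"

end

theory Submission
  imports Defs
begin

text \<open>
  Put \<open>\<nu> = \<alpha> + 1/2\<close>. Up to a constant factor \<open>phi_hat \<alpha> c\<close> is a mixture \<open>w\<close> of Gaussians in \<open>\<xi>\<close>, so that
  \<open>L_hat = w / P\<close> where \<open>P\<close> is the \<open>2 * pi\<close>-periodisation of \<open>w\<close>. The function \<open>w\<close> is smooth away from 0 and decays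
  rapidly together with its derivatives. At 0 it behaves like a smooth function plus \<open>\<bar>\<xi>\<bar> powr (- 2 * \<nu>)\<close>
  (possibly with a logarithm): if \<open>\<nu> < 0\<close> it has continuous derivatives of every order below \<open>- 2 * \<nu>\<close>, and
  if \<open>\<nu> > 0\<close> its reciprocal has bounded derivatives up to order \<open>2 * \<nu>\<close>. In either case the derivatives
  of \<open>L_hat\<close> up to the order \<open>n\<close> of the theorem are \<open>O(1 / (1 + \<xi>\<^sup>2))\<close>, and \<open>n\<close> integrations by parts give
  \<open>L_fund \<alpha> c x = O((1 + \<bar>x\<bar>) powr (- n))\<close>. As \<open>n \<ge> 2\<close>, the claims on the series follow from
  \<open>1 + \<bar>j\<bar> \<le> (1 + \<bar>x\<bar>) * (1 + \<bar>x - j\<bar>)\<close>. The values of \<open>L_hat\<close> at multiples of \<open>2 * pi\<close> are irrelevant,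
  since they form a null set.
\<close>

section \<open>Differentiation of integrals and series\<close>

text \<open>The order n is dictated by the singularity. For \<nu> > 0 the reciprocal of w behaves
  like \<bar>\<xi>\<bar>^(2\<nu>), whose derivative of order exactly 2\<nu> may jump but stays
  bounded; so n = floor(2\<alpha> + 1) \<le> 2\<nu> is admissible even with equality. For \<nu> < 0
  it is w itself that carries \<bar>\<xi>\<bar>^(-2\<nu>), with a logarithm when \<nu> is an
  integer; its derivative of order -2\<nu> can be unbounded. The ceiling in (b) keeps n strictly
  below -2\<nu> = 2\<bar>\<alpha>\<bar> - 1. The obstacle is that periodisation repeats the
  singularity at every multiple of 2 pi. Derivatives are therefore only required off this lattice,
  and regularity is proved on windows around its points. Two functions on the window around 0, 1/P
  and w/P, account for all windows: P is periodic, and near 2 pi j with j \<noteq> 0 the numerator w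
  is smooth and small. All decay of \<open>L_hat\<close> comes from this numerator.\<close>

lemma tendsto_at_integral_dominated:
  fixes f :: "real \<Rightarrow> 'a \<Rightarrow> 'b::{banach, second_countable_topology}"
  assumes meas: "\<forall>\<^sub>F h in at x. f h \<in> borel_measurable M"
    and bound: "\<forall>\<^sub>F h in at x. \<forall>t\<in>space M. norm (f h t) \<le> g t"
    and lim: "\<And>t. t \<in> space M \<Longrightarrow> ((\<lambda>h. f h t) \<longlongrightarrow> l t) (at x)"
    and g: "integrable M g"
  shows "((\<lambda>h. \<integral>t. f h t \<partial>M) \<longlongrightarrow> (\<integral>t. l t \<partial>M)) (at x)"
proof (unfold tendsto_at_iff_sequentially, intro allI impI)
  fix X :: "nat \<Rightarrow> real"
  assume X: "\<forall>i. X i \<in> UNIV - {x}" "X \<longlonglongrightarrow> x"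
  have XF: "filterlim X (at x) sequentially"
    using X by (auto simp: filterlim_at)
  from eventually_conj[OF meas bound] XF
  have "\<forall>\<^sub>F n in sequentially. f (X n) \<in> borel_measurable M \<and> (\<forall>t\<in>space M. norm (f (X n) t) \<le> g t)"
    by (rule eventually_compose_filterlim)
  \<comment> \<open>The hypotheses on \<open>f\<close> hold only near \<open>x\<close>, so dominated
    convergence is applied to the tail of the sequence from N on.\<close>
  then obtain N where N: "\<And>n. n \<ge> N \<Longrightarrow> f (X n) \<in> borel_measurable M \<and> (\<forall>t\<in>space M. norm (f (X n) t) \<le> g t)"
    by (auto simp: eventually_sequentially)
  have XlN: "(\<lambda>n. f (X (n + N)) t) \<longlonglongrightarrow> l t" if "t \<in> space M" for t
    using filterlim_compose[OF lim[OF that] XF] by (rule LIMSEQ_ignore_initial_segment)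
  have "l \<in> borel_measurable M"
    by (rule borel_measurable_LIMSEQ_metric[where f="\<lambda>n. f (X (n + N))"]) (use N XlN in auto)
  then have "(\<lambda>n. \<integral>t. f (X (n + N)) t \<partial>M) \<longlonglongrightarrow> (\<integral>t. l t \<partial>M)"
    by (rule integral_dominated_convergence[where w=g]) (use N XlN g in auto)
  then show "((\<lambda>h. \<integral>t. f h t \<partial>M) \<circ> X) \<longlonglongrightarrow> (\<integral>t. l t \<partial>M)"
    unfolding comp_def by (rule LIMSEQ_offset)
qed

text \<open>By the mean value inequality the bound \<open>g\<close> on the derivative also dominates
  all difference quotients, so dominated convergence applies to them.\<close>

lemma has_real_derivative_integral:
  fixes f :: "real \<Rightarrow> 'a \<Rightarrow> real"
  assumes d: "d > 0"
    and int: "\<And>y. y \<in> ball x d \<Longrightarrow> integrable M (f y)"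
    and der: "\<And>y t. y \<in> ball x d \<Longrightarrow> t \<in> space M \<Longrightarrow> ((\<lambda>y. f y t) has_real_derivative f' y t) (at y)"
    and bound: "\<And>y t. y \<in> ball x d \<Longrightarrow> t \<in> space M \<Longrightarrow> \<bar>f' y t\<bar> \<le> g t"
    and g: "integrable M g"
  shows "((\<lambda>y. \<integral>t. f y t \<partial>M) has_real_derivative (\<integral>t. f' x t \<partial>M)) (at x)"
proof -
  have near: "\<forall>\<^sub>F h in at (0::real). \<bar>h\<bar> < d \<and> h \<noteq> 0"
    using d by (auto simp: eventually_at dist_real_def)
  have inball: "x \<in> ball x d" "x + h \<in> ball x d" if "\<bar>h\<bar> < d" for h
    using that by (auto simp: dist_real_def)
  have lipschitz: "\<bar>(f (x + h) t - f x t) / h\<bar> \<le> g t" if h: "\<bar>h\<bar> < d" "h \<noteq> 0" and t: "t \<in> space M" for h t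
  proof -
    have "norm (f (x + h) t - f x t) \<le> g t * norm (x + h - x)"
      by (rule field_differentiable_bound[OF convex_ball[of x d], where f'="\<lambda>y. f' y t"])
         (use der[OF _ t] bound[OF _ t] inball[OF h(1)] in \<open>auto intro: has_field_derivative_at_within\<close>)
    then show ?thesis using h by (simp add: divide_simps)
  qed
  have "((\<lambda>h. \<integral>t. (f (x + h) t - f x t) / h \<partial>M) \<longlongrightarrow> (\<integral>t. f' x t \<partial>M)) (at 0)"
  proof (rule tendsto_at_integral_dominated[OF _ _ _ g])
    show "\<forall>\<^sub>F h in at 0. (\<lambda>t. (f (x + h) t - f x t) / h) \<in> borel_measurable M"
      using near
    proof eventually_elim
      case (elim h)
      have "integrable M (f x)" "integrable M (f (x+h))"
        using int inball[of h] elim by blast+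
      then show ?case by (intro borel_measurable_divide borel_measurable_diff) auto
    qed
    show "\<forall>\<^sub>F h in at 0. \<forall>t\<in>space M. norm ((f (x + h) t - f x t) / h) \<le> g t"
      using near by eventually_elim (use lipschitz in auto)
    show "((\<lambda>h. (f (x + h) t - f x t) / h) \<longlongrightarrow> f' x t) (at 0)" if "t \<in> space M" for t
      using der[of x t] that d by (simp add: DERIV_def)
  qed
  moreover have "\<forall>\<^sub>F h in at 0. (\<integral>t. (f (x + h) t - f x t) / h \<partial>M) =
      ((\<integral>t. f (x + h) t \<partial>M) - (\<integral>t. f x t \<partial>M)) / h"
    using near
  proof eventually_elim
    case (elim h)
    have "integrable M (f x)" "integrable M (f (x+h))"
      using int inball[of h] elim by blast+
    then show ?case by simp
  qed
  ultimately show ?thesis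
    unfolding DERIV_def using filterlim_cong by fast
qed

lemma integrable_count_space_iff_summable_on:
  fixes f :: "'a \<Rightarrow> real"
  shows "integrable (count_space J) f \<longleftrightarrow> (\<lambda>j. \<bar>f j\<bar>) summable_on J"
  using abs_summable_equivalent[of f J] by (simp add: Infinite_Set_Sum.abs_summable_on_def)

lemma infsum_eq_integral_count_space:
  fixes f :: "'a \<Rightarrow> real"
  assumes "(\<lambda>j. \<bar>f j\<bar>) summable_on J"
  shows "infsum f J = (\<integral>j. f j \<partial>count_space J)"
  using infsetsum_infsum[of f J] assms integrable_count_space_iff_summable_on[of J f]
  by (simp add: Infinite_Set_Sum.abs_summable_on_def infsetsum_def)

text \<open>A series is an integral against the counting measure, so termwise differentiation is an
  instance of differentiation under the integral sign.\<close>

lemma has_real_derivative_infsum: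
  fixes f :: "real \<Rightarrow> 'a \<Rightarrow> real"
  assumes U: "open U" "x \<in> U"
    and f: "\<And>y. y \<in> U \<Longrightarrow> (\<lambda>j. \<bar>f y j\<bar>) summable_on J"
    and der: "\<And>y j. y \<in> U \<Longrightarrow> j \<in> J \<Longrightarrow> ((\<lambda>y. f y j) has_real_derivative f' y j) (at y)"
    and bound: "\<And>y j. y \<in> U \<Longrightarrow> j \<in> J \<Longrightarrow> \<bar>f' y j\<bar> \<le> g j"
    and g: "g summable_on J"
  shows "((\<lambda>y. \<Sum>\<^sub>\<infinity>j\<in>J. f y j) has_real_derivative (\<Sum>\<^sub>\<infinity>j\<in>J. f' x j)) (at x)"
proof -
  from U obtain d where d: "d > 0" "ball x d \<subseteq> U"
    by (meson open_contains_ball)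
  have g0: "0 \<le> g j" if "j \<in> J" for j
    using bound[OF U(2) that] by linarith
  have gi: "(\<lambda>j. \<bar>g j\<bar>) summable_on J"
    using g g0 by (metis (no_types, lifting) abs_of_nonneg summable_on_cong)
  have f's: "(\<lambda>j. \<bar>f' x j\<bar>) summable_on J"
    by (rule summable_on_comparison_test[OF g]) (use bound U in auto)
  have "((\<lambda>y. \<integral>j. f y j \<partial>count_space J) has_real_derivative (\<integral>j. f' x j \<partial>count_space J)) (at x)"
    by (rule has_real_derivative_integral[OF d(1), where g=g])
       (use d f der bound gi in \<open>auto simp: integrable_count_space_iff_summable_on subset_iff\<close>)
  then have "((\<lambda>y. \<Sum>\<^sub>\<infinity>j\<in>J. f y j) has_real_derivative (\<integral>j. f' x j \<partial>count_space J)) (at x)"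
    by (rule has_field_derivative_transform_within_open[OF _ U])
       (use f in \<open>auto simp: infsum_eq_integral_count_space\<close>)
  then show ?thesis using f's by (simp add: infsum_eq_integral_count_space)
qed

section \<open>Functions with bounded derivatives\<close>

text \<open>
  The derivatives need not exist on the exceptional set \<open>E\<close>, but all of them except the last one must
  extend continuously across it; this is what makes the boundary terms at the points of \<open>E\<close> cancel in
  an integration by parts. The same \<open>M\<close> bounds all orders.
\<close>

fun bounded_derivs :: "real set \<Rightarrow> real set \<Rightarrow> nat \<Rightarrow> real \<Rightarrow> (real \<Rightarrow> real) \<Rightarrow> bool" where
  "bounded_derivs U E 0 M f \<longleftrightarrow> (\<forall>x\<in>U - E. \<bar>f x\<bar> \<le> M)"
| "bounded_derivs U E (Suc n) M f \<longleftrightarrow> (\<forall>x\<in>U - E. \<bar>f x\<bar> \<le> M) \<and> continuous_on U f \<and>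
     (\<exists>f'. (\<forall>x\<in>U - E. (f has_real_derivative f' x) (at x)) \<and> bounded_derivs U E n M f')"

lemma bounded_derivs_bound: "bounded_derivs U E n M f \<Longrightarrow> x \<in> U - E \<Longrightarrow> \<bar>f x\<bar> \<le> M"
  by (cases n) auto

lemma bounded_derivs_SucD: "bounded_derivs U E (Suc n) M f \<Longrightarrow> bounded_derivs U E n M f"
  by (induction n arbitrary: f) auto

lemma bounded_derivs_mono: "bounded_derivs U E n M f \<Longrightarrow> M \<le> N \<Longrightarrow> bounded_derivs U E n N f"
  by (induction n arbitrary: f) force+

text \<open>Agreement is asked for on \<open>E\<close> too, because the orders below the last one
  must be continuous across \<open>E\<close>.\<close>

lemma bounded_derivs_cong:
  assumes "bounded_derivs U E n M f" "open (U - E)" "\<And>x. x \<in> U \<Longrightarrow> f x = g x"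
  shows "bounded_derivs U E n M g"
proof (cases n)
  case 0
  then show ?thesis using assms by simp
next
  case (Suc m)
  with assms(1) obtain f' where f': "\<forall>x\<in>U - E. (f has_real_derivative f' x) (at x)" "bounded_derivs U E m M f'"
    "\<forall>x\<in>U - E. \<bar>f x\<bar> \<le> M" "continuous_on U f"
    by auto
  have "(g has_real_derivative f' x) (at x)" if "x \<in> U - E" for x
    by (rule has_field_derivative_transform_within_open[OF f'(1)[rule_format, OF that] assms(2) that])
       (use assms(3) in auto)
  moreover have "continuous_on U g"
    using f'(4) assms(3) by (metis continuous_on_cong)
  ultimately show ?thesis using f' Suc assms(3) by auto
qed

lemma bounded_derivs_add:
  "bounded_derivs U E n M f \<Longrightarrow> bounded_derivs U E n N g \<Longrightarrow> bounded_derivs U E n (M + N) (\<lambda>x. f x + g x)"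
proof (induction n arbitrary: f g)
  case 0
  then show ?case by (auto intro!: order_trans[OF abs_triangle_ineq] add_mono)
next
  case (Suc n)
  obtain f' where f': "\<forall>x\<in>U - E. (f has_real_derivative f' x) (at x)" "bounded_derivs U E n M f'"
    using Suc.prems(1) by auto
  obtain g' where g': "\<forall>x\<in>U - E. (g has_real_derivative g' x) (at x)" "bounded_derivs U E n N g'"
    using Suc.prems(2) by auto
  have "bounded_derivs U E n (M + N) (\<lambda>x. f' x + g' x)"
    by (rule Suc.IH[OF f'(2) g'(2)])
  moreover have "\<forall>x\<in>U - E. ((\<lambda>x. f x + g x) has_real_derivative f' x + g' x) (at x)"
    using f' g' by (auto intro!: derivative_intros)
  moreover have "\<forall>x\<in>U - E. \<bar>f x + g x\<bar> \<le> M + N"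
    using Suc.prems by (auto intro!: order_trans[OF abs_triangle_ineq] add_mono)
  moreover have "continuous_on U (\<lambda>x. f x + g x)"
    using Suc.prems by (auto intro!: continuous_intros)
  ultimately show ?case by auto
qed

text \<open>Each order of differentiation doubles the number of products in the Leibniz rule, which
  gives \<open>2 ^ n\<close>. The constant is explicit so that a bound decaying in an index j passes
  through products.\<close>

lemma bounded_derivs_mult:
  assumes "0 \<le> M" "0 \<le> N"
  shows "bounded_derivs U E n M f \<Longrightarrow> bounded_derivs U E n N g \<Longrightarrow>
    bounded_derivs U E n (2 ^ n * (M * N)) (\<lambda>x. f x * g x)"
proof (induction n arbitrary: f g)
  case 0
  then show ?case using assms by (auto simp: abs_mult intro!: mult_mono)
next
  case (Suc n)
  obtain f' where f': "\<forall>x\<in>U - E. (f has_real_derivative f' x) (at x)" "bounded_derivs U E n M f'"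
    using Suc.prems(1) by auto
  obtain g' where g': "\<forall>x\<in>U - E. (g has_real_derivative g' x) (at x)" "bounded_derivs U E n N g'"
    using Suc.prems(2) by auto
  have "bounded_derivs U E n (2 ^ n * (M * N) + 2 ^ n * (M * N)) (\<lambda>x. f' x * g x + f x * g' x)"
    by (rule bounded_derivs_add[OF Suc.IH[OF f'(2) bounded_derivs_SucD[OF Suc.prems(2)]]
          Suc.IH[OF bounded_derivs_SucD[OF Suc.prems(1)] g'(2)]])
  then have "bounded_derivs U E n (2 ^ Suc n * (M * N)) (\<lambda>x. f' x * g x + f x * g' x)"
    by (simp add: algebra_simps)
  moreover have "\<forall>x\<in>U - E. ((\<lambda>x. f x * g x) has_real_derivative f' x * g x + f x * g' x) (at x)"
    using f' g' by (auto intro!: derivative_eq_intros)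
  moreover have "\<bar>f x * g x\<bar> \<le> 2 ^ Suc n * (M * N)" if "x \<in> U - E" for x
  proof -
    have "\<bar>f x * g x\<bar> \<le> M * N"
      using bounded_derivs_bound[OF Suc.prems(1) that] bounded_derivs_bound[OF Suc.prems(2) that] assms
      by (auto simp: abs_mult intro!: mult_mono)
    also have "\<dots> \<le> 2 ^ Suc n * (M * N)"
      using assms mult_right_mono[of 1 "2 ^ Suc n" "M * N"] one_le_power[of "2::real" "Suc n"] by simp
    finally show ?thesis .
  qed
  moreover have "continuous_on U (\<lambda>x. f x * g x)"
    using Suc.prems by (auto intro!: continuous_intros)
  ultimately show ?case by auto
qed

lemma bounded_derivs_const: "bounded_derivs U E n \<bar>a\<bar> (\<lambda>x. a)"
proof -
  have "bounded_derivs U E n \<bar>a\<bar> (\<lambda>x. 0)" for n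
    by (induction n) (auto intro!: exI[of _ "\<lambda>x. 0"])
  then show ?thesis
    by (cases n) (auto intro!: exI[of _ "\<lambda>x. 0"])
qed

lemma bounded_derivs_cmult:
  assumes "bounded_derivs U E n M f" "0 \<le> M"
  shows "bounded_derivs U E n (2 ^ n * (\<bar>a\<bar> * M)) (\<lambda>x. a * f x)"
  using bounded_derivs_mult[OF _ assms(2) bounded_derivs_const assms(1), of a] by simp

text \<open>The derivative of 1/f is -f' (1/f)^2, so order n + 1 reduces to order n of f' and of 1/f
  itself.\<close>

lemma bounded_derivs_inverse:
  assumes \<delta>: "\<delta> > 0" and low: "\<And>x. x \<in> U \<Longrightarrow> \<delta> \<le> f x"
    and f: "bounded_derivs U E n M f"
  shows "\<exists>N\<ge>0. bounded_derivs U E n N (\<lambda>x. 1 / f x)"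
  using f
proof (induction n)
  have fpos: "f x > 0" if "x \<in> U" for x using low[OF that] \<delta> by linarith
  have bd: "\<bar>1 / f x\<bar> \<le> 1 / \<delta>" if "x \<in> U" for x
    using fpos[OF that] low[OF that] \<delta> by (simp add: frac_le)
  {
    case 0
    show ?case
      by (rule exI[of _ "1 / \<delta>"]) (use \<delta> bd in auto)
  next
    case (Suc n)
    obtain f' where f': "\<forall>x\<in>U - E. (f has_real_derivative f' x) (at x)" "bounded_derivs U E n M f'"
      using Suc.prems by auto
    from Suc.IH[OF bounded_derivs_SucD[OF Suc.prems]]
    obtain N where N: "N \<ge> 0" "bounded_derivs U E n N (\<lambda>x. 1 / f x)" by auto
    have f'2: "bounded_derivs U E n \<bar>M\<bar> f'" by (rule bounded_derivs_mono[OF f'(2)]) auto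
    define K where "K = 2^n * ((2^n*(\<bar>-1\<bar> * \<bar>M\<bar>)) * (2^n*(N*N)))"
    have K: "bounded_derivs U E n K (\<lambda>x. (-1 * f' x) * ((1 / f x) * (1 / f x)))"
      unfolding K_def using N
      by (intro bounded_derivs_mult[OF _ _ bounded_derivs_cmult[OF f'2] bounded_derivs_mult[OF _ _ N(2) N(2)]]) auto
    have "\<forall>x\<in>U - E. ((\<lambda>x. 1 / f x) has_real_derivative (-1 * f' x) * ((1 / f x) * (1 / f x))) (at x)"
      using f' fpos by (auto intro!: derivative_eq_intros simp: less_imp_neq[THEN not_sym])
    moreover have "bounded_derivs U E n (max K (1/\<delta>)) (\<lambda>x. (-1 * f' x) * ((1 / f x) * (1 / f x)))"
      by (rule bounded_derivs_mono[OF K]) simp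
    moreover have "\<forall>x\<in>U - E. \<bar>1 / f x\<bar> \<le> max K (1/\<delta>)"
      using bd by (auto simp: le_max_iff_disj)
    moreover have "continuous_on U (\<lambda>x. 1 / f x)"
      using Suc.prems fpos by (auto intro!: continuous_intros simp: less_imp_neq[THEN not_sym])
    ultimately have "bounded_derivs U E (Suc n) (max K (1/\<delta>)) (\<lambda>x. 1 / f x)"
      by (auto intro!: exI[of _ "\<lambda>x. (-1 * f' x) * ((1 / f x) * (1 / f x))"])
    moreover have "max K (1/\<delta>) \<ge> 0" using \<delta> by (simp add: le_max_iff_disj)
    ultimately show ?case by blast
  }
qed

text \<open>Since \<open>M\<close> dominates every order at once, the differentiated series
  satisfies the same hypotheses and the induction can continue.\<close>

lemma bounded_derivs_infsum:
  assumes U: "open U" and M: "M summable_on J"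
  shows "(\<And>j. j \<in> J \<Longrightarrow> bounded_derivs U {} n (M j) (f j)) \<Longrightarrow>
    bounded_derivs U {} n (infsum M J) (\<lambda>x. \<Sum>\<^sub>\<infinity>j\<in>J. f j x)"
proof -
  have summ: "(\<lambda>j. \<bar>f j x\<bar>) summable_on J" if "\<And>j. j \<in> J \<Longrightarrow> \<bar>f j x\<bar> \<le> M j" for f :: "'a \<Rightarrow> real \<Rightarrow> real" and x
    by (rule summable_on_comparison_test[OF M]) (use that in auto)
  have bd: "\<bar>\<Sum>\<^sub>\<infinity>j\<in>J. f j x\<bar> \<le> infsum M J" if *: "\<And>j. j \<in> J \<Longrightarrow> \<bar>f j x\<bar> \<le> M j" for f :: "'a \<Rightarrow> real \<Rightarrow> real" and x
  proof -
    have "norm (\<Sum>\<^sub>\<infinity>j\<in>J. f j x) \<le> (\<Sum>\<^sub>\<infinity>j\<in>J. norm (f j x))"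
      by (rule norm_infsum_bound) (use summ[of f, OF *] in simp)
    also have "\<dots> \<le> infsum M J"
      by (rule infsum_mono) (use summ[of f, OF *] M * in auto)
    finally show ?thesis by simp
  qed
  show "bounded_derivs U {} n (infsum M J) (\<lambda>x. \<Sum>\<^sub>\<infinity>j\<in>J. f j x)"
    if "\<And>j. j \<in> J \<Longrightarrow> bounded_derivs U {} n (M j) (f j)"
    using that
  proof (induction n arbitrary: f)
    case 0
    then show ?case using bd[of f] by auto
  next
    case (Suc n)
    have "\<forall>j\<in>J. \<exists>f'. (\<forall>x\<in>U. (f j has_real_derivative f' x) (at x)) \<and> bounded_derivs U {} n (M j) f'"
      using Suc.prems by auto
    then obtain f' where f': "\<And>j x. j \<in> J \<Longrightarrow> x \<in> U \<Longrightarrow> (f j has_real_derivative f' j x) (at x)"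
       "\<And>j. j \<in> J \<Longrightarrow> bounded_derivs U {} n (M j) (f' j)"
      by metis
    have fb: "\<bar>f j x\<bar> \<le> M j" "\<bar>f' j x\<bar> \<le> M j" if "j \<in> J" "x \<in> U" for j x
      using bounded_derivs_bound[OF Suc.prems[OF that(1)]] bounded_derivs_bound[OF f'(2)[OF that(1)]] that by auto
    have der: "((\<lambda>x. \<Sum>\<^sub>\<infinity>j\<in>J. f j x) has_real_derivative (\<Sum>\<^sub>\<infinity>j\<in>J. f' j x)) (at x)" if "x \<in> U" for x
      by (rule has_real_derivative_infsum[OF U that _ _ _ M]) (use fb f'(1) summ in auto)
    moreover have "continuous_on U (\<lambda>x. \<Sum>\<^sub>\<infinity>j\<in>J. f j x)"
      using der by (meson DERIV_isCont continuous_at_imp_continuous_on)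
    moreover have "bounded_derivs U {} n (infsum M J) (\<lambda>x. \<Sum>\<^sub>\<infinity>j\<in>J. f' j x)"
      by (rule Suc.IH) (use f' in auto)
    ultimately show ?case using bd[of f] fb by (auto intro!: exI[of _ "\<lambda>x. \<Sum>\<^sub>\<infinity>j\<in>J. f' j x"])
  qed
qed

lemma bounded_derivs_subset_exceptions:
  "bounded_derivs U {} n M f \<Longrightarrow> bounded_derivs U E n M f"
  by (induction n arbitrary: f) auto

section \<open>Gaussian mixtures and the Bessel function\<close>

lemma integrable_inverse_1_plus_square: "integrable lborel (\<lambda>t::real. 1 / (1 + t\<^sup>2))"
proof -
  have "set_integrable lborel (einterval (-\<infinity>) \<infinity>) (\<lambda>t::real. 1 / (1 + t\<^sup>2))"
    by (rule interval_integral_FTC_nonneg[where F=arctan and A="-pi/2" and B="pi/2"])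
       (auto intro!: derivative_eq_intros tendsto_arctan_at_top tendsto_arctan_at_bot
          simp: ereal_tendsto_simps add_nonneg_eq_0_iff inverse_eq_divide)
  then show ?thesis by (simp add: set_integrable_def)
qed

text \<open>The left side is maximal at z = p. In exponential form this is exp(-z) \<le> C z^(-p),
  which later trades an exponential for a power.\<close>

lemma ln_linear_bound:
  fixes p z :: real
  assumes "p \<ge> 0" "z > 0"
  shows "p * ln z - z \<le> p * ln p - p"
proof (cases "p = 0")
  case False
  with assms have p: "p > 0" by simp
  have "ln (z / p) \<le> z / p - 1" by (rule ln_le_minus_one) (use p assms in auto)
  then have "p * ln (z / p) \<le> p * (z / p - 1)" using p by simp
  then show ?thesis using p assms by (simp add: ln_div algebra_simps)
qed (use assms in simp)

text \<open>
  The translation \<open>t \<mapsto> t + ln \<bar>\<xi>\<bar>\<close> in the Bessel integral turns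
  \<open>2 * \<bar>\<xi>\<bar> powr (- \<nu>) * bessel_K \<nu> (2 * a * \<bar>\<xi>\<bar>)\<close> into this Gaussian mixture, which depends smoothly
  on \<open>\<xi>\<^sup>2\<close> and stays finite at \<open>\<xi> = 0\<close> when \<open>\<nu> < 0\<close>. For \<open>\<nu> \<ge> 0\<close> the value at 0 is the junk value of a
  divergent integral.
\<close>

definition mixture :: "real \<Rightarrow> real \<Rightarrow> real \<Rightarrow> real" where
  "mixture a \<nu> \<xi> = (LINT t|lborel. exp (\<nu> * t - a * exp (- t) - a * \<xi>\<^sup>2 * exp t))"

context
  fixes a :: real
  assumes a: "a > 0"
begin

lemma integrable_mixture_0:
  assumes "\<nu> < 0"
  shows "integrable lborel (\<lambda>t. exp (\<nu> * t - a * exp (- t)))"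
proof -
  define \<delta> where "\<delta> = - \<nu>"
  have \<delta>: "\<delta> > 0" using assms by (simp add: \<delta>_def)
  define C where "C = \<bar>2 * \<delta> * ln (2 * \<delta>) - 2 * \<delta> - 2 * \<delta> * ln a\<bar>"
  have "exp (\<nu> * t - a * exp (- t)) \<le> exp C * (1 + 2 / \<delta>\<^sup>2) * (1 / (1 + t\<^sup>2))" for t
  proof -
    \<comment> \<open>The exponent is 2\<delta> rather than \<delta>: for t < 0 one half compensates
      the growth of \<open>exp (\<nu> * t)\<close>, the other leaves the decay
      exp(-\<delta>\<bar>t\<bar>).\<close>
    have "2 * \<delta> * ln (a * exp (- t)) - a * exp (- t) \<le> 2 * \<delta> * ln (2 * \<delta>) - 2 * \<delta>"
      by (rule ln_linear_bound) (use \<delta> a in auto)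
    then have "- 2 * \<delta> * t - a * exp (- t) \<le> C"
      unfolding C_def using a by (simp add: ln_mult algebra_simps)
    moreover have "- a * exp (- t) \<le> C"
      using a by (simp add: C_def) (smt (verit) exp_gt_zero mult_pos_pos)
    ultimately have "\<nu> * t - a * exp (- t) \<le> C - \<delta> * \<bar>t\<bar>"
      by (cases "t \<ge> 0") (auto simp: \<delta>_def algebra_simps)
    then have "exp (\<nu> * t - a * exp (- t)) \<le> exp (C + - (\<delta> * \<bar>t\<bar>))"
      by simp
    also have "\<dots> = exp C * exp (- (\<delta> * \<bar>t\<bar>))"
      by (rule exp_add)
    also have "exp (- (\<delta> * \<bar>t\<bar>)) \<le> (1 + 2 / \<delta>\<^sup>2) * (1 / (1 + t\<^sup>2))"
    proof -
      have "1 + \<delta> * \<bar>t\<bar> + (\<delta> * \<bar>t\<bar>)\<^sup>2 / 2 \<le> exp (\<delta> * \<bar>t\<bar>)"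
        by (rule exp_lower_Taylor_quadratic) (use \<delta> in auto)
      then have "1 + \<delta>\<^sup>2 * t\<^sup>2 / 2 \<le> exp (\<delta> * \<bar>t\<bar>)"
        using \<delta> by (simp add: power_mult_distrib) (smt (verit) mult_nonneg_nonneg abs_ge_zero)
      then have "(1 + 2 / \<delta>\<^sup>2) * (1 + \<delta>\<^sup>2 * t\<^sup>2 / 2) \<le> (1 + 2 / \<delta>\<^sup>2) * exp (\<delta> * \<bar>t\<bar>)"
        by (intro mult_left_mono) auto
      moreover have "1 + t\<^sup>2 \<le> (1 + 2 / \<delta>\<^sup>2) * (1 + \<delta>\<^sup>2 * t\<^sup>2 / 2)"
        using \<delta> by (simp add: field_simps)
      ultimately have "1 + t\<^sup>2 \<le> (1 + 2 / \<delta>\<^sup>2) * exp (\<delta> * \<bar>t\<bar>)" by linarith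
      then have "(1 + t\<^sup>2) * exp (- (\<delta> * \<bar>t\<bar>)) \<le> (1 + 2 / \<delta>\<^sup>2) * exp (\<delta> * \<bar>t\<bar>) * exp (- (\<delta> * \<bar>t\<bar>))"
        by (rule mult_right_mono) simp
      also have "\<dots> = 1 + 2 / \<delta>\<^sup>2"
        by (simp add: mult.assoc flip: exp_add)
      finally have *: "exp (- (\<delta> * \<bar>t\<bar>)) * (1 + t\<^sup>2) \<le> 1 + 2 / \<delta>\<^sup>2" by (simp add: mult.commute)
      have "0 < 1 + t\<^sup>2" by (simp add: add_pos_nonneg)
      from pos_le_divide_eq[OF this, of "exp (- (\<delta> * \<bar>t\<bar>))" "1 + 2 / \<delta>\<^sup>2"] * show ?thesis by simp
    qed
    finally show ?thesis by (simp add: mult.assoc mult_left_mono)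
  qed
  then show ?thesis
    by (intro Bochner_Integration.integrable_bound[OF integrable_mult_right[OF integrable_inverse_1_plus_square, of "exp C * (1 + 2 / \<delta>\<^sup>2)"]])
       (auto intro!: AE_I2)
qed

text \<open>\<open>ln_linear_bound\<close> with z = a \<xi>^2 e^t replaces the factor exp(-z) by a
  multiple of z^(-p). This produces the power of \<bar>\<xi>\<bar> and lowers the order \<nu> by
  p.\<close>

lemma mixture_integrand_bound:
  assumes "p \<ge> 0" "\<xi> \<noteq> 0"
  shows "exp (\<nu> * t - a * exp (- t) - a * \<xi>\<^sup>2 * exp t) \<le>
    exp (p * ln p - p - p * ln a) * \<bar>\<xi>\<bar> powr (- 2 * p) * exp ((\<nu> - p) * t - a * exp (- t))"
proof -
  have "p * ln (a * \<xi>\<^sup>2 * exp t) - a * \<xi>\<^sup>2 * exp t \<le> p * ln p - p"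
    by (rule ln_linear_bound) (use assms a in auto)
  moreover have "ln (a * \<xi>\<^sup>2 * exp t) = ln a + 2 * ln \<bar>\<xi>\<bar> + t"
  proof -
    have "\<xi>\<^sup>2 = \<bar>\<xi>\<bar> ^ 2" by simp
    then show ?thesis using a assms by (simp only: ln_mult ln_exp ln_realpow) (simp add: ln_mult ln_realpow)
  qed
  ultimately have "\<nu> * t - a * exp (- t) - a * \<xi>\<^sup>2 * exp t \<le>
    (p * ln p - p - p * ln a) + (- 2 * p) * ln \<bar>\<xi>\<bar> + ((\<nu> - p) * t - a * exp (- t))"
    by (simp add: algebra_simps)
  then have "exp (\<nu> * t - a * exp (- t) - a * \<xi>\<^sup>2 * exp t) \<le>
    exp ((p * ln p - p - p * ln a) + (- 2 * p) * ln \<bar>\<xi>\<bar> + ((\<nu> - p) * t - a * exp (- t)))"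
    by simp
  also have "\<dots> = exp (p * ln p - p - p * ln a) * \<bar>\<xi>\<bar> powr (- 2 * p) * exp ((\<nu> - p) * t - a * exp (- t))"
    using assms by (simp only: exp_add powr_def) simp
  finally show ?thesis .
qed

lemma integrable_mixture:
  assumes "\<xi> \<noteq> 0 \<or> \<nu> < 0"
  shows "integrable lborel (\<lambda>t. exp (\<nu> * t - a * exp (- t) - a * \<xi>\<^sup>2 * exp t))"
proof (cases "\<xi> = 0")
  case True
  then show ?thesis using assms integrable_mixture_0[of \<nu>] by simp
next
  case False
  define p where "p = \<bar>\<nu>\<bar> + 1"
  have p: "p \<ge> 0" "\<nu> - p < 0" by (auto simp: p_def)
  show ?thesis
    by (rule Bochner_Integration.integrable_bound[OF integrable_mult_right[OF integrable_mixture_0[OF p(2)],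
           of "exp (p * ln p - p - p * ln a) * \<bar>\<xi>\<bar> powr (- 2 * p)"]])
       (use mixture_integrand_bound[OF p(1) False, of \<nu>] in \<open>auto intro!: AE_I2\<close>)
qed

text \<open>Large p yields decay at infinity, p close to \<nu> the size at 0. At p = \<nu> the
  remaining integral of order 0 diverges; this is the source of the strict inequality in
  \<open>bdd_derivs_mixture_neg\<close>.\<close>

lemma mixture_powr_bound:
  assumes "p \<ge> 0" "p > \<nu>"
  shows "\<exists>C\<ge>0. \<forall>\<xi>. \<xi> \<noteq> 0 \<longrightarrow> mixture a \<nu> \<xi> \<le> C * \<bar>\<xi>\<bar> powr (- 2 * p)"
proof -
  have "\<nu> - p < 0" using assms by simp
  note int0 = integrable_mixture_0[OF this]
  define C where "C = exp (p * ln p - p - p * ln a) * (LINT t|lborel. exp ((\<nu> - p) * t - a * exp (- t)))"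
  have "C \<ge> 0" unfolding C_def by (intro mult_nonneg_nonneg integral_nonneg_AE) auto
  moreover have "mixture a \<nu> \<xi> \<le> C * \<bar>\<xi>\<bar> powr (- 2 * p)" if "\<xi> \<noteq> 0" for \<xi>
  proof -
    have "mixture a \<nu> \<xi> \<le> (LINT t|lborel. exp (p * ln p - p - p * ln a) * \<bar>\<xi>\<bar> powr (- 2 * p) * exp ((\<nu> - p) * t - a * exp (- t)))"
      unfolding mixture_def
      by (intro integral_mono integrable_mixture integrable_mult_right int0 mixture_integrand_bound) (use that assms in auto)
    also have "\<dots> = C * \<bar>\<xi>\<bar> powr (- 2 * p)"
      by (simp add: C_def)
    finally show ?thesis .
  qed
  ultimately show ?thesis by blast
qed

lemma mixture_nonneg: "0 \<le> mixture a \<nu> \<xi>"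
  unfolding mixture_def by (intro integral_nonneg_AE) auto

lemma mixture_pos:
  assumes "\<xi> \<noteq> 0 \<or> \<nu> < 0"
  shows "0 < mixture a \<nu> \<xi>"
proof (rule ccontr)
  assume "\<not> ?thesis"
  then have "(LINT t|lborel. exp (\<nu> * t - a * exp (- t) - a * \<xi>\<^sup>2 * exp t)) = 0"
    using mixture_nonneg[of \<nu> \<xi>] unfolding mixture_def by linarith
  then have "AE t in lborel. exp (\<nu> * t - a * exp (- t) - a * \<xi>\<^sup>2 * exp t) = 0"
    using integral_nonneg_eq_0_iff_AE[OF integrable_mixture[OF assms]] by simp
  then have "AE t in (lborel :: real measure). False" by simp
  then show False by (simp add: AE_iff_measurable[OF _ refl])
qed

lemma mixture_antimono:
  assumes "\<bar>\<xi>\<bar> \<le> \<bar>\<eta>\<bar>" "\<xi> \<noteq> 0 \<or> \<nu> < 0"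
  shows "mixture a \<nu> \<eta> \<le> mixture a \<nu> \<xi>"
  unfolding mixture_def
proof (rule integral_mono)
  show "integrable lborel (\<lambda>t. exp (\<nu> * t - a * exp (- t) - a * \<eta>\<^sup>2 * exp t))"
    "integrable lborel (\<lambda>t. exp (\<nu> * t - a * exp (- t) - a * \<xi>\<^sup>2 * exp t))"
    using assms by (auto intro!: integrable_mixture)
  have "\<xi>\<^sup>2 \<le> \<eta>\<^sup>2" using assms(1) by (simp add: abs_le_square_iff)
  then show "exp (\<nu> * t - a * exp (- t) - a * \<eta>\<^sup>2 * exp t) \<le> exp (\<nu> * t - a * exp (- t) - a * \<xi>\<^sup>2 * exp t)" for t
    using a by (simp add: mult_left_mono mult_right_mono)
qed

text \<open>This is the symmetry K_\<nu> = K_(-\<nu>): the substitution t -> s - t with s = -2 ln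
  \<bar>\<xi>\<bar> exchanges the two exponentials. For \<nu> > 0 it splits off the singular power
  and leaves a mixture that is finite at 0.\<close>

lemma mixture_reflect:
  assumes "\<xi> \<noteq> 0"
  shows "mixture a \<nu> \<xi> = \<bar>\<xi>\<bar> powr (- 2 * \<nu>) * mixture a (- \<nu>) \<xi>"
proof -
  define s where "s = - 2 * ln \<bar>\<xi>\<bar>"
  have e: "exp (- s) = \<xi>\<^sup>2"
  proof -
    have "exp (- s) = exp (ln \<bar>\<xi>\<bar>) ^ 2" by (simp add: s_def flip: exp_of_nat_mult)
    then show ?thesis using assms by simp
  qed
  then have e': "exp s * \<xi>\<^sup>2 = 1" by (metis exp_minus_inverse)
  have "mixture a \<nu> \<xi> = (LINT t|lborel. exp (\<nu> * (s + - 1 * t) - a * exp (- (s + - 1 * t)) - a * \<xi>\<^sup>2 * exp (s + - 1 * t)))"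
    unfolding mixture_def by (subst lborel_integral_real_affine[where c="-1" and t=s]) auto
  also have "\<dots> = (LINT t|lborel. exp (\<nu> * s) * exp ((- \<nu>) * t - a * exp (- t) - a * \<xi>\<^sup>2 * exp t))"
  proof (rule Bochner_Integration.integral_cong[OF refl])
    fix t :: real
    have "exp (- (s + - 1 * t)) = \<xi>\<^sup>2 * exp t" by (simp add: exp_add e[symmetric] exp_diff exp_minus field_simps)
    moreover have "\<xi>\<^sup>2 * exp (s + - 1 * t) = exp (- t)"
      using e' by (simp add: exp_add exp_diff exp_minus field_simps)
    ultimately show "exp (\<nu> * (s + - 1 * t) - a * exp (- (s + - 1 * t)) - a * \<xi>\<^sup>2 * exp (s + - 1 * t)) =
       exp (\<nu> * s) * exp ((- \<nu>) * t - a * exp (- t) - a * \<xi>\<^sup>2 * exp t)"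
      by (simp add: mult.assoc algebra_simps flip: exp_add)
  qed
  also have "\<dots> = exp (\<nu> * s) * mixture a (- \<nu>) \<xi>" by (simp add: mixture_def)
  also have "exp (\<nu> * s) = \<bar>\<xi>\<bar> powr (- 2 * \<nu>)" using assms by (simp add: powr_def s_def)
  finally show ?thesis .
qed

text \<open>The derivative of the Gaussian brings down \<open>exp t\<close>, which raises the order
  by 1. This is the recurrence (x^(-\<nu>) K_\<nu>(x))' = -x^(-\<nu>) K_(\<nu>+1)(x).\<close>

lemma mixture_has_derivative:
  assumes \<xi>: "\<xi> \<noteq> 0"
  shows "(mixture a \<nu> has_real_derivative (- 2 * a) * \<xi> * mixture a (\<nu> + 1) \<xi>) (at \<xi>)"
proof -
  \<comment> \<open>On the ball of this radius the modulus stays between d and 3d, so the integrand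
    taken at d dominates.\<close>
  define d where "d = \<bar>\<xi>\<bar> / 2"
  have d: "d > 0" using \<xi> by (simp add: d_def)
  have near: "d \<le> \<bar>y\<bar> \<and> \<bar>y\<bar> \<le> 3 * d \<and> y \<noteq> 0" if "y \<in> ball \<xi> d" for y
    using that d abs_triangle_ineq2[of \<xi> y] abs_triangle_ineq2[of y \<xi>]
    by (auto simp: dist_real_def d_def abs_minus_commute)
  have "((\<lambda>y. LINT t|lborel. exp (\<nu> * t - a * exp (- t) - a * y\<^sup>2 * exp t)) has_real_derivative
     (LINT t|lborel. (- 2 * a) * \<xi> * exp ((\<nu> + 1) * t - a * exp (- t) - a * \<xi>\<^sup>2 * exp t))) (at \<xi>)"
  proof (rule has_real_derivative_integral[OF d, where g="\<lambda>t. 2 * a * (3 * d) * exp ((\<nu> + 1) * t - a * exp (- t) - a * d\<^sup>2 * exp t)"])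
    show "integrable lborel (\<lambda>t. exp (\<nu> * t - a * exp (- t) - a * y\<^sup>2 * exp t))" if "y \<in> ball \<xi> d" for y
      using near[OF that] by (intro integrable_mixture) auto
    show "integrable lborel (\<lambda>t. 2 * a * (3 * d) * exp ((\<nu> + 1) * t - a * exp (- t) - a * d\<^sup>2 * exp t))"
      using d by (intro integrable_mult_right integrable_mixture) auto
    show "((\<lambda>y. exp (\<nu> * t - a * exp (- t) - a * y\<^sup>2 * exp t)) has_real_derivative
         (- 2 * a) * y * exp ((\<nu> + 1) * t - a * exp (- t) - a * y\<^sup>2 * exp t)) (at y)" for y t
      by (auto intro!: derivative_eq_intros simp: algebra_simps exp_add exp_diff)
    show "\<bar>(- 2 * a) * y * exp ((\<nu> + 1) * t - a * exp (- t) - a * y\<^sup>2 * exp t)\<bar> \<le>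
       2 * a * (3 * d) * exp ((\<nu> + 1) * t - a * exp (- t) - a * d\<^sup>2 * exp t)" if "y \<in> ball \<xi> d" for y t
    proof -
      have "d\<^sup>2 \<le> y\<^sup>2" using near[OF that] d by (simp add: abs_le_square_iff[symmetric])
      then have "exp ((\<nu> + 1) * t - a * exp (- t) - a * y\<^sup>2 * exp t) \<le> exp ((\<nu> + 1) * t - a * exp (- t) - a * d\<^sup>2 * exp t)"
        using a by (simp add: mult_left_mono mult_right_mono)
      then have "2 * a * \<bar>y\<bar> * exp ((\<nu> + 1) * t - a * exp (- t) - a * y\<^sup>2 * exp t) \<le>
         2 * a * (3 * d) * exp ((\<nu> + 1) * t - a * exp (- t) - a * d\<^sup>2 * exp t)"
        using near[OF that] a d by (intro mult_mono) auto
      then show ?thesis using a by (simp add: abs_mult)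
    qed
  qed
  then show ?thesis by (simp add: mixture_def[abs_def])
qed

lemma mixture_isCont_0:
  assumes "\<nu> < 0"
  shows "isCont (mixture a \<nu>) 0"
  unfolding isCont_def mixture_def[abs_def]
proof (rule tendsto_at_integral_dominated[OF _ _ _ integrable_mixture_0[OF assms]])
  show "((\<lambda>\<xi>. exp (\<nu> * t - a * exp (- t) - a * \<xi>\<^sup>2 * exp t)) \<longlongrightarrow> exp (\<nu> * t - a * exp (- t) - a * 0\<^sup>2 * exp t)) (at 0)" for t
    by (intro tendsto_intros)
  show "\<forall>\<^sub>F h in at 0. \<forall>t\<in>space lborel. norm (exp (\<nu> * t - a * exp (- t) - a * h\<^sup>2 * exp t)) \<le> exp (\<nu> * t - a * exp (- t))"
    using a by (intro always_eventually) auto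
qed auto

lemma bessel_K_eq_mixture:
  assumes "\<xi> \<noteq> 0"
  shows "bessel_K \<nu> (2 * a * \<bar>\<xi>\<bar>) = \<bar>\<xi>\<bar> powr \<nu> * mixture a \<nu> \<xi> / 2"
proof -
  define x where "x = 2 * a * \<bar>\<xi>\<bar>"
  define h where "h = (\<lambda>t. exp (\<nu> * t - x * cosh t))"
  have shift: "exp (\<nu> * (ln \<bar>\<xi>\<bar> + 1 * t) - x * cosh (ln \<bar>\<xi>\<bar> + 1 * t)) =
      \<bar>\<xi>\<bar> powr \<nu> * exp (\<nu> * t - a * exp (- t) - a * \<xi>\<^sup>2 * exp t)" for t
  proof -
    have "x * cosh (ln \<bar>\<xi>\<bar> + 1 * t) = a * exp (- t) + a * \<xi>\<^sup>2 * exp t"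
      using assms by (simp add: x_def cosh_def exp_add exp_diff exp_minus field_simps power2_eq_square)
    then show ?thesis using assms by (simp add: powr_def algebra_simps flip: exp_add)
  qed
  have "integrable lborel (\<lambda>t. h (ln \<bar>\<xi>\<bar> + 1 * t))"
    unfolding h_def shift by (intro integrable_mult_right integrable_mixture) (use assms in auto)
  then have hint: "integrable lborel h"
    by (subst (asm) lborel_integrable_real_affine_iff) auto
  have hint': "integrable lborel (\<lambda>t. h (- t))"
    using lborel_integrable_real_affine[OF hint, of "-1" 0] by simp
  have "(LINT t|lborel. h t) = (LINT t|lborel. h (ln \<bar>\<xi>\<bar> + 1 * t))"
    by (subst lborel_integral_real_affine[where c=1 and t="ln \<bar>\<xi>\<bar>"]) auto
  also have "\<dots> = \<bar>\<xi>\<bar> powr \<nu> * mixture a \<nu> \<xi>"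
    unfolding h_def shift by (simp add: mixture_def)
  finally have full: "(LINT t|lborel. h t) = \<bar>\<xi>\<bar> powr \<nu> * mixture a \<nu> \<xi>" .
  have set1: "set_integrable lborel {0..} h" "set_integrable lborel {0..} (\<lambda>t. h (- t))"
    unfolding set_integrable_def
    by (intro integrable_mult_indicator hint hint'; simp)+
  \<comment> \<open>Both exponentials of \<open>cosh (\<nu> * t)\<close> occur, so the half-line
    integral is half the integral of \<open>h\<close> over the whole line; this is the factor 1/2 of
    the claim.\<close>
  have "exp (- x * cosh t) * cosh (\<nu> * t) = (h t + h (- t)) / 2" for t
  proof -
    have "h t = exp (\<nu> * t) * exp (- x * cosh t)" "h (- t) = exp (- (\<nu> * t)) * exp (- x * cosh t)"
      by (simp_all add: h_def flip: exp_add)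
    then show ?thesis by (simp add: cosh_def algebra_simps)
  qed
  then have "bessel_K \<nu> x = (LINT t:{0..}|lborel. (h t + h (- t)) / 2)"
    unfolding bessel_K_def by (intro set_lebesgue_integral_cong) auto
  also have "\<dots> = ((LINT t:{0..}|lborel. h t) + (LINT t:{0..}|lborel. h (- t))) / 2"
    using set1 by (simp add: set_integral_add)
  also have "(LINT t:{0..}|lborel. h (- t)) = (LINT t:{..0}|lborel. h t)"
    unfolding set_lebesgue_integral_def
    by (subst lborel_integral_real_affine[where c="-1" and t=0])
       (auto intro!: Bochner_Integration.integral_cong simp: indicator_def)
  \<comment> \<open>Dropping the null set {0} makes the two half-lines disjoint.\<close>
  also have "\<dots> = (LINT t:{..<0}|lborel. h t)"
    by (rule set_integral_discrete_difference[where X="{0}"]) auto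
  also have "(LINT t:{0..}|lborel. h t) + (LINT t:{..<0}|lborel. h t) = (LINT t:{0..}\<union>{..<0}|lborel. h t)"
    by (rule set_integral_Un[symmetric]) (use integrable_mult_indicator[OF _ hint] in \<open>auto simp: set_integrable_def\<close>)
  also have "{0..} \<union> {..<0} = (UNIV :: real set)" by auto
  also have "(LINT t:UNIV|lborel. h t) = (LINT t|lborel. h t)"
    by (simp add: set_lebesgue_integral_def)
  finally show ?thesis using full by (simp add: x_def)
qed

end

section \<open>Bounds on a single window, and sums over the lattice\<close>

text \<open>On the window around 0 the size of the bound does not matter; it has to be tracked only
  where it depends on j. The sign condition supplies the hypotheses of the product rule.\<close>

definition bdd_derivs :: "real set \<Rightarrow> real set \<Rightarrow> nat \<Rightarrow> (real \<Rightarrow> real) \<Rightarrow> bool" where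
  "bdd_derivs U E n f \<longleftrightarrow> (\<exists>M\<ge>0. bounded_derivs U E n M f)"

lemma bdd_derivsI: "bounded_derivs U E n M f \<Longrightarrow> bdd_derivs U E n f"
  unfolding bdd_derivs_def using bounded_derivs_mono[of U E n M f "\<bar>M\<bar>"] by (intro exI[of _ "\<bar>M\<bar>"]) simp

lemma bdd_derivs_add: "bdd_derivs U E n f \<Longrightarrow> bdd_derivs U E n g \<Longrightarrow> bdd_derivs U E n (\<lambda>x. f x + g x)"
  unfolding bdd_derivs_def using bounded_derivs_add by (meson add_nonneg_nonneg)

lemma bdd_derivs_mult: "bdd_derivs U E n f \<Longrightarrow> bdd_derivs U E n g \<Longrightarrow> bdd_derivs U E n (\<lambda>x. f x * g x)"
  by (metis bdd_derivsI bdd_derivs_def bounded_derivs_mult)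

lemma bdd_derivs_const: "bdd_derivs U E n (\<lambda>x. a)"
  using bdd_derivsI[OF bounded_derivs_const] .

lemma bdd_derivs_cmult: "bdd_derivs U E n f \<Longrightarrow> bdd_derivs U E n (\<lambda>x. a * f x)"
  by (rule bdd_derivs_mult[OF bdd_derivs_const])

lemma bdd_derivs_inverse:
  assumes "\<delta> > 0" "\<And>x. x \<in> U \<Longrightarrow> \<delta> \<le> f x" "bdd_derivs U E n f"
  shows "bdd_derivs U E n (\<lambda>x. 1 / f x)"
proof -
  obtain M where "bounded_derivs U E n M f" using assms(3) by (auto simp: bdd_derivs_def)
  from bounded_derivs_inverse[OF assms(1,2) this] show ?thesis by (simp add: bdd_derivs_def)
qed

lemma bdd_derivs_SucI:
  assumes "\<And>x. x \<in> U - E \<Longrightarrow> \<bar>f x\<bar> \<le> M" "continuous_on U f"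
    "\<And>x. x \<in> U - E \<Longrightarrow> (f has_real_derivative f' x) (at x)" "bdd_derivs U E n f'"
  shows "bdd_derivs U E (Suc n) f"
proof -
  obtain N where N: "N \<ge> 0" "bounded_derivs U E n N f'"
    using assms(4) by (auto simp: bdd_derivs_def)
  have "bounded_derivs U E n (max M N) f'" by (rule bounded_derivs_mono[OF N(2)]) simp
  with assms(1-3) have "bounded_derivs U E (Suc n) (max M N) f"
    by (auto simp: le_max_iff_disj)
  then show ?thesis by (rule bdd_derivsI)
qed

lemma tendsto_0_of_powr_bound:
  fixes f :: "real \<Rightarrow> real"
  assumes "\<And>\<xi>. \<xi> \<noteq> 0 \<Longrightarrow> \<bar>\<xi>\<bar> < 1 \<Longrightarrow> \<bar>f \<xi>\<bar> \<le> C * \<bar>\<xi>\<bar> powr q" "q > 0"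
  shows "(f \<longlongrightarrow> 0) (at 0)"
proof (rule Lim_null_comparison)
  show "\<forall>\<^sub>F \<xi> in at 0. norm (f \<xi>) \<le> C * \<bar>\<xi>\<bar> powr q"
    unfolding eventually_at using assms(1) by (intro exI[of _ 1]) (auto simp: dist_real_def)
  have "((\<lambda>\<xi>::real. \<bar>\<xi>\<bar> powr q) \<longlongrightarrow> 0) (at 0)"
    by (rule tendsto_zero_powrI[where b=q]) (use assms(2) in \<open>auto intro!: tendsto_eq_intros\<close>)
  then show "((\<lambda>\<xi>. C * \<bar>\<xi>\<bar> powr q) \<longlongrightarrow> 0) (at 0)"
    by (rule tendsto_mult_right_zero)
qed

lemma summable_on_int_powr:
  fixes s :: real
  assumes "s > 1"
  shows "(\<lambda>j::int. (1 + \<bar>real_of_int j\<bar>) powr (- s)) summable_on UNIV"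
proof -
  let ?g = "\<lambda>j::int. (1 + \<bar>real_of_int j\<bar>) powr (- s)"
  have "summable (\<lambda>n. real (Suc n) powr (- s))"
    using assms summable_Suc_iff[of "\<lambda>n. real n powr (- s)"] by (simp add: summable_real_powr_iff)
  then have nat: "(\<lambda>n. real (Suc n) powr (- s)) summable_on UNIV"
    by (subst summable_on_UNIV_nonneg_real_iff) auto
  have "?g summable_on (range int)"
    by (subst summable_on_reindex) (use nat in \<open>auto simp: comp_def add.commute\<close>)
  moreover have "?g summable_on (range (\<lambda>n. - int n))"
    by (subst summable_on_reindex) (use nat in \<open>auto simp: comp_def add.commute inj_on_def\<close>)
  moreover have "range int \<union> range (\<lambda>n. - int n) = UNIV"
    by (metis (no_types, lifting) UNIV_I UNIV_eq_I UnI1 UnI2 int_cases2 range_eqI)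
  ultimately show ?thesis
    using summable_on_union by metis
qed

lemma summable_on_int_inverse_square:
  "(\<lambda>j::int. C / (real_of_int j)\<^sup>2) summable_on (- {0})"
proof -
  have "(\<lambda>j::int. (1 + \<bar>real_of_int j\<bar>) powr (- 2)) summable_on (- {0})"
    using summable_on_int_powr[of 2] by (rule summable_on_subset) auto
  then have "(\<lambda>j::int. 4 * (1 + \<bar>real_of_int j\<bar>) powr (- 2)) summable_on (- {0})"
    by (rule summable_on_cmult_right)
  then have "(\<lambda>j::int. 1 / (real_of_int j)\<^sup>2) summable_on (- {0})"
  proof (rule summable_on_comparison_test)
    fix j :: int assume "j \<in> - {0}"
    then have j: "\<bar>real_of_int j\<bar> \<ge> 1" by auto
    then have "(1 + \<bar>real_of_int j\<bar>)\<^sup>2 \<le> (2 * \<bar>real_of_int j\<bar>)\<^sup>2"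
      by (intro power_mono) auto
    then have "(1 + \<bar>real_of_int j\<bar>)\<^sup>2 \<le> 4 * (real_of_int j)\<^sup>2"
      by (simp add: power_mult_distrib)
    moreover have "(1 + \<bar>real_of_int j\<bar>) powr (- 2) = 1 / (1 + \<bar>real_of_int j\<bar>)\<^sup>2"
      by (simp add: powr_minus_divide)
    moreover have "0 < (1 + \<bar>real_of_int j\<bar>)\<^sup>2" "0 < (real_of_int j)\<^sup>2"
      using j by (auto intro!: zero_less_power)
    ultimately show "1 / (real_of_int j)\<^sup>2 \<le> 4 * (1 + \<bar>real_of_int j\<bar>) powr (- 2)"
      by (simp only: pos_divide_le_eq) (simp only: times_divide_eq_right times_divide_eq_left mult_1_right pos_le_divide_eq mult_1)
  qed auto
  then have "(\<lambda>j::int. C * (1 / (real_of_int j)\<^sup>2)) summable_on (- {0})"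
    by (rule summable_on_cmult_right)
  then show ?thesis by simp
qed

text \<open>2 pi > 6 and \<bar>\<xi>\<bar> < 4 \<le> 4\<bar>j\<bar>. Hence no translate of the
  window by a nonzero j contains 0.\<close>

lemma abs_shift_ge:
  fixes \<xi> :: real and j :: int
  assumes "\<bar>\<xi>\<bar> < 4" "j \<noteq> 0"
  shows "2 * \<bar>real_of_int j\<bar> \<le> \<bar>\<xi> + 2 * pi * real_of_int j\<bar>"
proof -
  have j: "\<bar>real_of_int j\<bar> \<ge> 1" using assms(2) by auto
  have "pi > 3" using pi_gt3 .
  then have "6 * \<bar>real_of_int j\<bar> \<le> 2 * pi * \<bar>real_of_int j\<bar>" by (intro mult_right_mono) auto
  also have "\<dots> = \<bar>2 * pi * real_of_int j\<bar>" by (simp add: abs_mult)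
  also have "\<dots> \<le> \<bar>\<xi> + 2 * pi * real_of_int j\<bar> + \<bar>\<xi>\<bar>" by linarith
  finally show ?thesis using assms j by linarith
qed

section \<open>Derivatives of the mixture near 0 and on translated windows\<close>

context
  fixes a :: real
  assumes a: "a > 0"
begin

text \<open>The family \<xi>^k \<open>mixture a m \<xi>\<close> is closed under differentiation, and
  both resulting terms lower k - 2m by exactly 1: (k - 1) - 2m = (k + 1) - 2(m + 1). For k = 0 the
  truncated \<open>k - 1\<close> is masked by the factor 0.\<close>

lemma mixture_monomial_has_derivative:
  assumes "\<xi> \<noteq> 0"
  shows "((\<lambda>\<xi>. \<xi> ^ k * mixture a m \<xi>) has_real_derivative
    real k * (\<xi> ^ (k - 1) * mixture a m \<xi>) + (- 2 * a) * (\<xi> ^ (k + 1) * mixture a (m + 1) \<xi>)) (at \<xi>)"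
  by (rule derivative_eq_intros mixture_has_derivative[OF a assms] refl)+ (simp add: algebra_simps)

text \<open>k - 2m is the degree at 0 of the singular part \<xi>^k \<bar>\<xi>\<bar>^(-2m). Each
  derivative lowers it by 1, and a positive degree gives boundedness.\<close>

lemma bdd_derivs_mixture_neg:
  "real n < real k - 2 * m \<Longrightarrow> bdd_derivs {-4<..<4} {0} n (\<lambda>\<xi>. \<xi> ^ k * mixture a m \<xi>)"
proof (induction n arbitrary: k m)
  have bound: "\<exists>C. \<forall>\<xi>. \<xi> \<noteq> 0 \<longrightarrow> \<bar>\<xi> ^ k * mixture a m \<xi>\<bar> \<le> C * \<bar>\<xi>\<bar> powr (real k - 2 * p)"
    if p: "p \<ge> 0" "p > m" for k m p
  proof -
    obtain C where C: "C \<ge> 0" "\<And>\<xi>. \<xi> \<noteq> 0 \<Longrightarrow> mixture a m \<xi> \<le> C * \<bar>\<xi>\<bar> powr (- 2 * p)"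
      using mixture_powr_bound[OF a p] by auto
    have "\<bar>\<xi> ^ k * mixture a m \<xi>\<bar> \<le> C * \<bar>\<xi>\<bar> powr (real k - 2 * p)" if "\<xi> \<noteq> 0" for \<xi>
    proof -
      have "\<bar>\<xi> ^ k * mixture a m \<xi>\<bar> = \<bar>\<xi>\<bar> powr real k * mixture a m \<xi>"
        using that mixture_nonneg[OF a, of m \<xi>] by (simp add: abs_mult power_abs powr_realpow)
      also have "\<dots> \<le> \<bar>\<xi>\<bar> powr real k * (C * \<bar>\<xi>\<bar> powr (- 2 * p))"
        by (intro mult_left_mono C that) auto
      also have "\<dots> = C * \<bar>\<xi>\<bar> powr (real k - 2 * p)"
        by (simp add: powr_add[symmetric] mult.left_commute)
      finally show ?thesis .
    qed
    then show ?thesis by blast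
  qed
  have bound0: "\<exists>C. \<forall>\<xi>\<in>{-4<..<4} - {0}. \<bar>\<xi> ^ k * mixture a m \<xi>\<bar> \<le> C" if "0 < real k - 2 * m" for k m
    using bound[of "real k / 2" m k] that by auto
  {
    case 0
    then show ?case using bound0[of k m] bdd_derivsI by fastforce
  next
    case (Suc n)
    let ?f = "\<lambda>\<xi>. \<xi> ^ k * mixture a m \<xi>"
    let ?f' = "\<lambda>\<xi>. real k * (\<xi> ^ (k - 1) * mixture a m \<xi>) + (- 2 * a) * (\<xi> ^ (k + 1) * mixture a (m + 1) \<xi>)"
    obtain C where C: "\<And>\<xi>. \<xi> \<in> {-4<..<4} - {0} \<Longrightarrow> \<bar>?f \<xi>\<bar> \<le> C"
      using bound0[of k m] Suc.prems by (force simp del: Diff_iff)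
    have "bdd_derivs {-4<..<4} {0} n ?f'"
      by (intro bdd_derivs_add[OF bdd_derivs_cmult[OF Suc.IH[of "k - 1" m]] bdd_derivs_cmult[OF Suc.IH[of "k + 1" "m + 1"]]])
         (use Suc.prems in \<open>auto simp: of_nat_diff split: nat_diff_split\<close>)
    moreover have "isCont ?f \<xi>" for \<xi>
    proof (cases "\<xi> = 0")
      case False
      then show ?thesis using DERIV_isCont[OF mixture_monomial_has_derivative] by blast
    next
      case \<xi>0: True
      show ?thesis
      proof (cases "k = 0")
        case True
        then show ?thesis using \<xi>0 mixture_isCont_0[OF a, of m] Suc.prems by simp
      next
        case False
        \<comment> \<open>Any p strictly between m and k/2 leaves a positive power of
          \<bar>\<xi>\<bar>; this is the midpoint, raised to 0 if negative.\<close>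
        define p where "p = max 0 ((m + real k / 2) / 2)"
        have p: "p \<ge> 0" "p > m" "real k - 2 * p > 0"
          using Suc.prems False by (auto simp: p_def max_def)
        obtain C where C: "\<And>\<xi>. \<xi> \<noteq> 0 \<Longrightarrow> \<bar>?f \<xi>\<bar> \<le> C * \<bar>\<xi>\<bar> powr (real k - 2 * p)"
          using bound[OF p(1,2), of k] by auto
        have "(?f \<longlongrightarrow> 0) (at 0)"
          by (rule tendsto_0_of_powr_bound[OF C p(3)])
        \<comment> \<open>For k > 0 the factor 0^k makes the value at 0 equal to 0, whatever
          \<open>mixture a m 0\<close> is.\<close>
        then show ?thesis using False \<xi>0 by (simp add: isCont_def zero_power)
      qed
    qed
    ultimately show ?case
      by (intro bdd_derivs_SucI[where f'="?f'", OF C _ mixture_monomial_has_derivative] continuous_at_imp_continuous_on)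
         (simp_all del: Diff_iff, simp)
  }
qed

text \<open>The translated windows avoid 0, so there is no exceptional point and every order n is
  available. Of the rapid decay only the exponent 2 is kept: it makes the series of translates
  summable and the transform integrable.\<close>

lemma bounded_derivs_mixture_shift:
  "\<exists>C\<ge>0. \<forall>j::int. j \<noteq> 0 \<longrightarrow> bounded_derivs {-4<..<4} {} n (C / (real_of_int j)\<^sup>2)
     (\<lambda>\<xi>. (\<xi> + 2 * pi * of_int j) ^ k * mixture a m (\<xi> + 2 * pi * of_int j))"
proof (induction n arbitrary: k m)
  have bound: "\<exists>C\<ge>0. \<forall>(j::int) \<xi>. j \<noteq> 0 \<longrightarrow> \<bar>\<xi>\<bar> < 4 \<longrightarrow>
      \<bar>(\<xi> + 2 * pi * of_int j) ^ k * mixture a m (\<xi> + 2 * pi * of_int j)\<bar> \<le> C / (real_of_int j)\<^sup>2" for k m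
  proof -
    \<comment> \<open>The summand \<bar>m\<bar> guarantees p > m, and k/2 + 1 gives k - 2p \<le>
      -2.\<close>
    define p where "p = \<bar>m\<bar> + real k / 2 + 1"
    have p: "p \<ge> 0" "p > m" "real k - 2 * p \<le> - 2" by (auto simp: p_def)
    obtain C where C: "C \<ge> 0" "\<And>\<xi>. \<xi> \<noteq> 0 \<Longrightarrow> mixture a m \<xi> \<le> C * \<bar>\<xi>\<bar> powr (- 2 * p)"
      using mixture_powr_bound[OF a p(1,2)] by auto
    have "\<bar>(\<xi> + 2 * pi * of_int j) ^ k * mixture a m (\<xi> + 2 * pi * of_int j)\<bar> \<le> C / (real_of_int j)\<^sup>2"
      if "j \<noteq> 0" "\<bar>\<xi>\<bar> < 4" for j \<xi>
    proof -
      define \<eta> where "\<eta> = \<xi> + 2 * pi * real_of_int j"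
      have \<eta>: "2 * \<bar>real_of_int j\<bar> \<le> \<bar>\<eta>\<bar>" unfolding \<eta>_def by (rule abs_shift_ge) (use that in auto)
      have j: "1 \<le> \<bar>real_of_int j\<bar>" using that by auto
      then have \<eta>1: "1 \<le> \<bar>\<eta>\<bar>" "\<bar>real_of_int j\<bar> \<le> \<bar>\<eta>\<bar>" using \<eta> by auto
      then have \<eta>0: "\<eta> \<noteq> 0" by auto
      have "\<bar>\<eta> ^ k * mixture a m \<eta>\<bar> = \<bar>\<eta>\<bar> powr real k * mixture a m \<eta>"
        using \<eta>0 mixture_nonneg[OF a, of m \<eta>] by (simp add: abs_mult power_abs powr_realpow)
      also have "\<dots> \<le> \<bar>\<eta>\<bar> powr real k * (C * \<bar>\<eta>\<bar> powr (- 2 * p))"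
        by (intro mult_left_mono C \<eta>0) auto
      also have "\<dots> = C * \<bar>\<eta>\<bar> powr (real k - 2 * p)"
        by (simp add: powr_add[symmetric] mult.left_commute)
      also have "\<dots> \<le> C * \<bar>\<eta>\<bar> powr (- 2)"
        by (intro mult_left_mono powr_mono C \<eta>1 p)
      also have "\<bar>\<eta>\<bar> powr (- 2) = 1 / \<bar>\<eta>\<bar>\<^sup>2"
        using \<eta>0 by (simp add: powr_minus_divide)
      also have "C * (1 / \<bar>\<eta>\<bar>\<^sup>2) \<le> C * (1 / \<bar>real_of_int j\<bar>\<^sup>2)"
        using \<eta>1 j by (intro mult_left_mono C divide_left_mono power_mono mult_pos_pos) auto
      finally show ?thesis by (simp add: \<eta>_def)
    qed
    then show ?thesis using C(1) by blast
  qed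
  {
    case 0
    then show ?case using bound[of k m] by (auto simp: abs_less_iff)
  next
    case (Suc n)
    let ?f = "\<lambda>j \<xi>. (\<xi> + 2 * pi * real_of_int j) ^ k * mixture a m (\<xi> + 2 * pi * real_of_int j)"
    let ?g = "\<lambda>k m j \<xi>. (\<xi> + 2 * pi * real_of_int j) ^ k * mixture a m (\<xi> + 2 * pi * real_of_int j)"
    let ?f' = "\<lambda>j \<xi>. real k * ?g (k - 1) m j \<xi> + (- 2 * a) * ?g (k + 1) (m + 1) j \<xi>"
    obtain C0 where C0: "C0 \<ge> 0" "\<And>j \<xi>. j \<noteq> 0 \<Longrightarrow> \<bar>\<xi>\<bar> < 4 \<Longrightarrow> \<bar>?f j \<xi>\<bar> \<le> C0 / (real_of_int j)\<^sup>2"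
      using bound[of k m] by auto
    obtain C1 where C1: "C1 \<ge> 0" "\<And>j. j \<noteq> 0 \<Longrightarrow> bounded_derivs {-4<..<4} {} n (C1 / (real_of_int j)\<^sup>2) (?g (k - 1) m j)"
      using Suc.IH[of "k - 1" m] by auto
    obtain C2 where C2: "C2 \<ge> 0" "\<And>j. j \<noteq> 0 \<Longrightarrow> bounded_derivs {-4<..<4} {} n (C2 / (real_of_int j)\<^sup>2) (?g (k + 1) (m + 1) j)"
      using Suc.IH[of "k + 1" "m + 1"] by auto
    define C where "C = C0 + 2 ^ n * (\<bar>real k\<bar> * C1) + 2 ^ n * (\<bar>- 2 * a\<bar> * C2)"
    have C: "C \<ge> 0" "C0 \<le> C" "2 ^ n * (\<bar>real k\<bar> * C1) + 2 ^ n * (\<bar>- 2 * a\<bar> * C2) \<le> C"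
      using C0(1) C1(1) C2(1) by (auto simp: C_def)
    have "bounded_derivs {-4<..<4} {} (Suc n) (C / (real_of_int j)\<^sup>2) (?f j)" if j: "j \<noteq> 0" for j
    proof -
      have nz: "\<xi> + 2 * pi * real_of_int j \<noteq> 0" if "\<xi> \<in> {-4<..<4}" for \<xi>
        using abs_shift_ge[of \<xi> j] that j by (auto simp: abs_less_iff)
      have "0 \<le> C1 / (real_of_int j)\<^sup>2" "0 \<le> C2 / (real_of_int j)\<^sup>2"
        using C1(1) C2(1) by auto
      then have b: "bounded_derivs {-4<..<4} {} n (2 ^ n * (\<bar>real k\<bar> * (C1 / (real_of_int j)\<^sup>2)) + 2 ^ n * (\<bar>- 2 * a\<bar> * (C2 / (real_of_int j)\<^sup>2))) (?f' j)"
        using bounded_derivs_add[OF bounded_derivs_cmult[OF C1(2)[OF j]] bounded_derivs_cmult[OF C2(2)[OF j]]] by blast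
      have e: "2 ^ n * (\<bar>real k\<bar> * (C1 / (real_of_int j)\<^sup>2)) + 2 ^ n * (\<bar>- 2 * a\<bar> * (C2 / (real_of_int j)\<^sup>2)) =
          (2 ^ n * (\<bar>real k\<bar> * C1) + 2 ^ n * (\<bar>- 2 * a\<bar> * C2)) / (real_of_int j)\<^sup>2"
        by (simp add: add_divide_distrib)
      have le: "\<dots> \<le> C / (real_of_int j)\<^sup>2"
        by (rule divide_right_mono[OF C(3)]) simp
      have "bounded_derivs {-4<..<4} {} n (C / (real_of_int j)\<^sup>2) (?f' j)"
        by (rule bounded_derivs_mono[OF b]) (use le in \<open>simp only: e\<close>)
      moreover have "C0 / (real_of_int j)\<^sup>2 \<le> C / (real_of_int j)\<^sup>2"
        by (rule divide_right_mono[OF C(2)]) simp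
      then have "\<forall>\<xi>\<in>{-4<..<4}. \<bar>?f j \<xi>\<bar> \<le> C / (real_of_int j)\<^sup>2"
        using order_trans[OF C0(2)[OF j]] by (simp add: abs_less_iff)
      moreover have der: "(?f j has_real_derivative ?f' j \<xi>) (at \<xi>)" if "\<xi> \<in> {-4<..<4}" for \<xi>
        using mixture_monomial_has_derivative[OF nz[OF that], of k m]
        by (rule DERIV_chain2[THEN DERIV_cong]) (auto intro!: derivative_eq_intros)
      moreover have "continuous_on {-4<..<4} (?f j)"
        using der DERIV_isCont continuous_at_imp_continuous_on by blast
      ultimately show ?thesis
        by (auto intro!: exI[of _ "?f' j"])
    qed
    then show ?case using C(1) by blast
  }
qed

end

section \<open>The quotient near a multiple of the period\<close>

text \<open>
  An algebra of functions, bounded near 0, that is closed under the Euler operator \<open>\<xi> * d/d\<xi>\<close>. Since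
  \<open>1 / mixture a \<nu> \<xi>\<close> is of size \<open>\<bar>\<xi>\<bar> powr (2 * \<nu>)\<close> and its logarithmic Euler derivative lies in the algebra,
  its \<open>i\<close>-th derivative is of size \<open>\<bar>\<xi>\<bar> powr (2 * \<nu> - i)\<close>.
\<close>

inductive_set euler_algebra :: "real \<Rightarrow> real \<Rightarrow> (real \<Rightarrow> real) set" for a \<nu> where
  const: "(\<lambda>\<xi>. c) \<in> euler_algebra a \<nu>"
| ratio: "(\<lambda>\<xi>. \<xi> ^ (2 * m) * mixture a (\<nu> + real m) \<xi> / mixture a \<nu> \<xi>) \<in> euler_algebra a \<nu>"
| add: "f \<in> euler_algebra a \<nu> \<Longrightarrow> g \<in> euler_algebra a \<nu> \<Longrightarrow> (\<lambda>\<xi>. f \<xi> + g \<xi>) \<in> euler_algebra a \<nu>"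
| mult: "f \<in> euler_algebra a \<nu> \<Longrightarrow> g \<in> euler_algebra a \<nu> \<Longrightarrow> (\<lambda>\<xi>. f \<xi> * g \<xi>) \<in> euler_algebra a \<nu>"

context
  fixes a :: real
  assumes a: "a > 0"
begin

text \<open>With b_m for the generator of index m, \<xi> b_m' = 2m b_m - 2a b_(m+1) + 2a b_m b_1,
  where the last term comes from the denominator. Sums and products follow because \<xi> d/d\<xi> is
  a derivation.\<close>

lemma euler_algebra_has_derivative:
  "f \<in> euler_algebra a \<nu> \<Longrightarrow>
    \<exists>g\<in>euler_algebra a \<nu>. \<forall>\<xi>. \<xi> \<noteq> 0 \<longrightarrow> (f has_real_derivative g \<xi> / \<xi>) (at \<xi>)"
proof (induction rule: euler_algebra.induct)
  case (const c)
  show ?case by (rule bexI[OF _ euler_algebra.const[of 0]]) auto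
next
  case (ratio m)
  let ?b = "\<lambda>m \<xi>. \<xi> ^ (2 * m) * mixture a (\<nu> + real m) \<xi> / mixture a \<nu> \<xi>"
  let ?g = "\<lambda>\<xi>. (real (2 * m) * ?b m \<xi> + (- 2 * a) * ?b (Suc m) \<xi>) + (2 * a) * (?b m \<xi> * ?b 1 \<xi>)"
  have g: "?g \<in> euler_algebra a \<nu>"
    by (intro euler_algebra.intros)
  have der: "(?b m has_real_derivative ?g \<xi> / \<xi>) (at \<xi>)" if \<xi>: "\<xi> \<noteq> 0" for \<xi>
  proof -
    have pos: "mixture a \<nu> \<xi> \<noteq> 0" using mixture_pos[OF a, of \<xi> \<nu>] \<xi> by simp
    have pw: "real (2 * m) * \<xi> ^ (2 * m - 1) = real (2 * m) * \<xi> ^ (2 * m) / \<xi>"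
      using \<xi> by (cases m) (auto simp: field_simps)
    have "(?b m has_real_derivative
       ((real (2 * m) * (\<xi> ^ (2 * m - 1) * mixture a (\<nu> + real m) \<xi>) + (- 2 * a) * (\<xi> ^ (2 * m + 1) * mixture a (\<nu> + real m + 1) \<xi>)) * mixture a \<nu> \<xi>
         - \<xi> ^ (2 * m) * mixture a (\<nu> + real m) \<xi> * ((- 2 * a) * \<xi> * mixture a (\<nu> + 1) \<xi>)) / (mixture a \<nu> \<xi> * mixture a \<nu> \<xi>)) (at \<xi>)"
      by (rule DERIV_divide[OF mixture_monomial_has_derivative[OF a \<xi>] mixture_has_derivative[OF a \<xi>] pos])
    also have "((real (2 * m) * (\<xi> ^ (2 * m - 1) * mixture a (\<nu> + real m) \<xi>) + (- 2 * a) * (\<xi> ^ (2 * m + 1) * mixture a (\<nu> + real m + 1) \<xi>)) * mixture a \<nu> \<xi>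
         - \<xi> ^ (2 * m) * mixture a (\<nu> + real m) \<xi> * ((- 2 * a) * \<xi> * mixture a (\<nu> + 1) \<xi>)) / (mixture a \<nu> \<xi> * mixture a \<nu> \<xi>) = ?g \<xi> / \<xi>"
    proof -
      \<comment> \<open>The identity is shown for independent real variables, so that powers and
        mixtures are opaque to the simplifier. The hypothesis on X' covers the truncated exponent 2m
        - 1 at m = 0.\<close>
      have "((k * (X' * A) + (- 2 * a) * (X * x * B)) * w - X * A * ((- 2 * a) * x * D)) / (w * w) =
         ((k * (X * A / w) + (- 2 * a) * (X * x\<^sup>2 * B / w)) + (2 * a) * ((X * A / w) * (x\<^sup>2 * D / w))) / x"
        if "k * X' = k * X / x" "x \<noteq> 0" "w \<noteq> 0" for k X X' A B D w x :: real
      proof -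
        have *: "k * (X' * A) = k * X / x * A" by (simp only: mult.assoc[symmetric] that(1))
        show ?thesis using that(2,3) unfolding * by (simp add: divide_simps) (simp add: algebra_simps power2_eq_square)
      qed
      from this[OF pw \<xi> pos, of "mixture a (\<nu> + real m) \<xi>" "mixture a (\<nu> + real m + 1) \<xi>" "mixture a (\<nu> + 1) \<xi>"]
      show ?thesis by (simp add: power2_eq_square ac_simps)
    qed
    finally show ?thesis .
  qed
  show ?case
    by (rule bexI[OF _ g]) (intro allI impI der)
next
  case (add f g)
  then obtain f' g' where "f' \<in> euler_algebra a \<nu>" "\<forall>\<xi>. \<xi> \<noteq> 0 \<longrightarrow> (f has_real_derivative f' \<xi> / \<xi>) (at \<xi>)"
    "g' \<in> euler_algebra a \<nu>" "\<forall>\<xi>. \<xi> \<noteq> 0 \<longrightarrow> (g has_real_derivative g' \<xi> / \<xi>) (at \<xi>)"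
    by blast
  then show ?case
    by (intro bexI[OF _ euler_algebra.add[of f' a \<nu> g']]) (auto intro!: derivative_eq_intros simp: add_divide_distrib)
next
  case (mult f g)
  then obtain f' g' where "f' \<in> euler_algebra a \<nu>" "\<forall>\<xi>. \<xi> \<noteq> 0 \<longrightarrow> (f has_real_derivative f' \<xi> / \<xi>) (at \<xi>)"
    "g' \<in> euler_algebra a \<nu>" "\<forall>\<xi>. \<xi> \<noteq> 0 \<longrightarrow> (g has_real_derivative g' \<xi> / \<xi>) (at \<xi>)"
    by blast
  then show ?case using mult.hyps
    by (intro bexI[OF _ euler_algebra.add[OF euler_algebra.mult[of f' a \<nu> g] euler_algebra.mult[of f a \<nu> g']]])
       (auto intro!: derivative_eq_intros simp: add_divide_distrib)
qed

text \<open>\<open>mixture_reflect\<close> separates the singular power; the remaining mixture of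
  order -\<nu> decreases in \<bar>\<xi>\<bar>, so its value at the window edge 4 is a lower
  bound.\<close>

lemma mixture_lower_bound:
  assumes "\<nu> > 0" "\<xi> \<in> {-4<..<4} - {0}"
  shows "mixture a (- \<nu>) 4 * \<bar>\<xi>\<bar> powr (- 2 * \<nu>) \<le> mixture a \<nu> \<xi>"
proof -
  have "mixture a (- \<nu>) 4 \<le> mixture a (- \<nu>) \<xi>"
    by (rule mixture_antimono[OF a]) (use assms in auto)
  then show ?thesis
    using mixture_reflect[OF a, of \<xi> \<nu>] assms by (simp add: mult.commute mult_left_mono)
qed

text \<open>For a generator, reflection gives numerator and denominator the same power
  \<bar>\<xi>\<bar>^(-2\<nu>). What is left is bounded above by its value at 0 in the numerator and
  below by its value at 4 in the denominator.\<close>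

lemma euler_algebra_bound:
  assumes \<nu>: "\<nu> > 0"
  shows "f \<in> euler_algebra a \<nu> \<Longrightarrow> \<exists>C\<ge>0. \<forall>\<xi>\<in>{-4<..<4} - {0}. \<bar>f \<xi>\<bar> \<le> C"
proof (induction rule: euler_algebra.induct)
  case (const c)
  show ?case by (rule exI[of _ "\<bar>c\<bar>"]) simp
next
  case (ratio m)
  define L where "L = mixture a (- \<nu>) 4"
  define K where "K = mixture a (- (\<nu> + real m)) 0"
  have L: "L > 0" unfolding L_def by (rule mixture_pos[OF a]) simp
  have K: "K \<ge> 0" unfolding K_def by (rule mixture_nonneg[OF a])
  have "\<bar>\<xi> ^ (2 * m) * mixture a (\<nu> + real m) \<xi> / mixture a \<nu> \<xi>\<bar> \<le> K / L" if \<xi>: "\<xi> \<in> {-4<..<4} - {0}" for \<xi>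
  proof -
    have \<xi>0: "\<xi> \<noteq> 0" using \<xi> by simp
    have "\<bar>\<xi> ^ (2 * m) * mixture a (\<nu> + real m) \<xi>\<bar> = \<bar>\<xi>\<bar> powr (2 * real m) * mixture a (\<nu> + real m) \<xi>"
      using \<xi>0 mixture_nonneg[OF a, of "\<nu> + real m" \<xi>] powr_realpow[of "\<bar>\<xi>\<bar>" "2 * m"]
      by (simp add: abs_mult power_abs)
    also have "\<dots> = \<bar>\<xi>\<bar> powr (- 2 * \<nu>) * mixture a (- (\<nu> + real m)) \<xi>"
      by (subst mixture_reflect[OF a \<xi>0]) (simp add: powr_add[symmetric] mult.assoc[symmetric])
    also have "\<dots> \<le> \<bar>\<xi>\<bar> powr (- 2 * \<nu>) * K"
      unfolding K_def by (intro mult_left_mono mixture_antimono[OF a]) (use \<nu> in auto)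
    finally have num: "\<bar>\<xi> ^ (2 * m) * mixture a (\<nu> + real m) \<xi>\<bar> \<le> \<bar>\<xi>\<bar> powr (- 2 * \<nu>) * K" .
    have den: "L * \<bar>\<xi>\<bar> powr (- 2 * \<nu>) \<le> \<bar>mixture a \<nu> \<xi>\<bar>"
      unfolding L_def using mixture_lower_bound[OF \<nu> \<xi>] mixture_nonneg[OF a, of \<nu> \<xi>] by simp
    have pp: "\<bar>\<xi>\<bar> powr (- 2 * \<nu>) > 0" using \<xi>0 by simp
    have "\<bar>\<xi> ^ (2 * m) * mixture a (\<nu> + real m) \<xi>\<bar> / \<bar>mixture a \<nu> \<xi>\<bar> \<le> (\<bar>\<xi>\<bar> powr (- 2 * \<nu>) * K) / (L * \<bar>\<xi>\<bar> powr (- 2 * \<nu>))"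
      by (rule frac_le[OF _ num _ den]) (use L K pp in auto)
    also have "\<dots> = K / L" using pp by simp
    finally show ?thesis by (simp add: abs_divide)
  qed
  then show ?case using L K by (intro exI[of _ "K / L"]) auto
next
  case (add f g)
  then obtain C D where "C \<ge> 0" "D \<ge> 0" and *: "\<forall>\<xi>\<in>{-4<..<4} - {0}. \<bar>f \<xi>\<bar> \<le> C" "\<forall>\<xi>\<in>{-4<..<4} - {0}. \<bar>g \<xi>\<bar> \<le> D"
    by blast
  moreover have "\<bar>f \<xi> + g \<xi>\<bar> \<le> C + D" if "\<xi> \<in> {-4<..<4} - {0}" for \<xi>
    using *(1)[rule_format, OF that] *(2)[rule_format, OF that] by linarith
  ultimately show ?case by (intro exI[of _ "C + D"]) simp
next
  case (mult f g)
  then obtain C D where CD: "C \<ge> 0" "D \<ge> 0" and *: "\<forall>\<xi>\<in>{-4<..<4} - {0}. \<bar>f \<xi>\<bar> \<le> C" "\<forall>\<xi>\<in>{-4<..<4} - {0}. \<bar>g \<xi>\<bar> \<le> D"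
    by blast
  moreover have "\<bar>f \<xi> * g \<xi>\<bar> \<le> C * D" if "\<xi> \<in> {-4<..<4} - {0}" for \<xi>
    using *(1)[rule_format, OF that] *(2)[rule_format, OF that] CD by (auto simp: abs_mult intro!: mult_mono)
  ultimately show ?case by (intro exI[of _ "C * D"]) simp
qed

text \<open>With w = \<open>mixture a \<nu>\<close>, the derivative of f / (w \<xi>^i) has the same
  form with i + 1 and another element of the algebra, and the size is \<bar>\<xi>\<bar>^(2\<nu> -
  i). So i + n is invariant and boundedness lasts up to i = 2\<nu>. While a derivative remains to be
  taken, 2\<nu> - i > 0 and the value 0 at 0 is the continuous one.\<close>

lemma bdd_derivs_euler_algebra:
  assumes \<nu>: "\<nu> > 0"
  shows "f \<in> euler_algebra a \<nu> \<Longrightarrow> real (i + n) \<le> 2 * \<nu> \<Longrightarrow>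
    bdd_derivs {-4<..<4} {0} n (\<lambda>\<xi>. if \<xi> = 0 then 0 else f \<xi> / (mixture a \<nu> \<xi> * \<xi> ^ i))"
proof (induction n arbitrary: f i)
  have bound: "\<exists>C. \<forall>\<xi>\<in>{-4<..<4} - {0}. \<bar>f \<xi> / (mixture a \<nu> \<xi> * \<xi> ^ i)\<bar> \<le> C * \<bar>\<xi>\<bar> powr (2 * \<nu> - real i)"
    if f: "f \<in> euler_algebra a \<nu>" for f i
  proof -
    obtain C where C: "C \<ge> 0" "\<And>\<xi>. \<xi> \<in> {-4<..<4} - {0} \<Longrightarrow> \<bar>f \<xi>\<bar> \<le> C"
      using euler_algebra_bound[OF \<nu> f] by blast
    define L where "L = mixture a (- \<nu>) 4"
    have L: "L > 0" unfolding L_def by (rule mixture_pos[OF a]) simp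
    have "\<bar>f \<xi> / (mixture a \<nu> \<xi> * \<xi> ^ i)\<bar> \<le> C / L * \<bar>\<xi>\<bar> powr (2 * \<nu> - real i)"
      if \<xi>: "\<xi> \<in> {-4<..<4} - {0}" for \<xi>
    proof -
      have \<xi>0: "\<xi> \<noteq> 0" using \<xi> by simp
      have "L * \<bar>\<xi>\<bar> powr (- 2 * \<nu>) * \<bar>\<xi>\<bar> powr real i \<le> mixture a \<nu> \<xi> * \<bar>\<xi>\<bar> powr real i"
        unfolding L_def by (intro mult_right_mono mixture_lower_bound \<nu> \<xi>) auto
      also have "\<dots> = \<bar>mixture a \<nu> \<xi> * \<xi> ^ i\<bar>"
        using \<xi>0 mixture_nonneg[OF a, of \<nu> \<xi>] by (simp add: abs_mult power_abs powr_realpow)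
      finally have den: "L * \<bar>\<xi>\<bar> powr (- 2 * \<nu>) * \<bar>\<xi>\<bar> powr real i \<le> \<bar>mixture a \<nu> \<xi> * \<xi> ^ i\<bar>" .
      have "\<bar>f \<xi>\<bar> / \<bar>mixture a \<nu> \<xi> * \<xi> ^ i\<bar> \<le> C / (L * \<bar>\<xi>\<bar> powr (- 2 * \<nu>) * \<bar>\<xi>\<bar> powr real i)"
        by (rule frac_le[OF C(1) C(2)[OF \<xi>] _ den]) (use L \<xi>0 in auto)
      also have "\<dots> = C / (L * \<bar>\<xi>\<bar> powr (- (2 * \<nu> - real i)))"
        by (simp add: mult.assoc powr_add[symmetric] add.commute)
      also have "\<dots> = C / L * \<bar>\<xi>\<bar> powr (2 * \<nu> - real i)"
        by (subst powr_minus) (simp add: divide_simps)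
      finally show ?thesis by (simp add: abs_divide)
    qed
    then show ?thesis by blast
  qed
  have bound0: "\<exists>C. \<forall>\<xi>\<in>{-4<..<4} - {0}. \<bar>f \<xi> / (mixture a \<nu> \<xi> * \<xi> ^ i)\<bar> \<le> C"
    if f: "f \<in> euler_algebra a \<nu>" and i: "real i \<le> 2 * \<nu>" for f i
  proof -
    obtain C where C: "\<And>\<xi>. \<xi> \<in> {-4<..<4} - {0} \<Longrightarrow> \<bar>f \<xi> / (mixture a \<nu> \<xi> * \<xi> ^ i)\<bar> \<le> C * \<bar>\<xi>\<bar> powr (2 * \<nu> - real i)"
      using bound[OF f] by blast
    have "\<bar>f \<xi> / (mixture a \<nu> \<xi> * \<xi> ^ i)\<bar> \<le> \<bar>C\<bar> * 4 powr (2 * \<nu> - real i)" if \<xi>: "\<xi> \<in> {-4<..<4} - {0}" for \<xi>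
    proof -
      have "C * \<bar>\<xi>\<bar> powr (2 * \<nu> - real i) \<le> \<bar>C\<bar> * \<bar>\<xi>\<bar> powr (2 * \<nu> - real i)"
        by (intro mult_right_mono) auto
      also have "\<dots> \<le> \<bar>C\<bar> * 4 powr (2 * \<nu> - real i)"
        using \<xi> i by (intro mult_left_mono powr_mono2) auto
      finally show ?thesis using C[OF \<xi>] by linarith
    qed
    then show ?thesis by blast
  qed
  {
    case 0
    from bound0[OF 0(1), of i] 0(2) obtain C where "\<forall>\<xi>\<in>{-4<..<4} - {0}. \<bar>f \<xi> / (mixture a \<nu> \<xi> * \<xi> ^ i)\<bar> \<le> C"
      by auto
    then show ?case by (intro bdd_derivsI[where M=C]) simp
  next
    case (Suc n)
    let ?F = "\<lambda>\<xi>. if \<xi> = 0 then 0 else f \<xi> / (mixture a \<nu> \<xi> * \<xi> ^ i)"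
    let ?b = "\<lambda>m \<xi>. \<xi> ^ (2 * m) * mixture a (\<nu> + real m) \<xi> / mixture a \<nu> \<xi>"
    obtain g where g: "g \<in> euler_algebra a \<nu>" "\<And>\<xi>. \<xi> \<noteq> 0 \<Longrightarrow> (f has_real_derivative g \<xi> / \<xi>) (at \<xi>)"
      using euler_algebra_has_derivative[OF Suc.prems(1)] by blast
    \<comment> \<open>This is \<xi> f' - f (\<xi> w'/w) - i f, where \<xi> w'/w = -2a
      \<open>?b 1\<close>.\<close>
    let ?h = "\<lambda>\<xi>. (g \<xi> + (2 * a) * (?b 1 \<xi> * f \<xi>)) + (- real i) * f \<xi>"
    have h: "?h \<in> euler_algebra a \<nu>"
      by (intro euler_algebra.intros g Suc.prems)
    let ?F' = "\<lambda>\<xi>. if \<xi> = 0 then 0 else ?h \<xi> / (mixture a \<nu> \<xi> * \<xi> ^ Suc i)"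
    have F': "bdd_derivs {-4<..<4} {0} n ?F'"
      by (rule Suc.IH[OF h]) (use Suc.prems in simp)
    have der: "(?F has_real_derivative ?F' \<xi>) (at \<xi>)" if \<xi>: "\<xi> \<noteq> 0" for \<xi>
    proof -
      have pos: "mixture a \<nu> \<xi> \<noteq> 0" using mixture_pos[OF a, of \<xi> \<nu>] \<xi> by simp
      have pw: "real i * \<xi> ^ (i - Suc 0) = real i * \<xi> ^ i / \<xi>"
        using \<xi> by (cases i) (auto simp: field_simps)
      have D: "((\<lambda>\<xi>. f \<xi> / (mixture a \<nu> \<xi> * \<xi> ^ i)) has_real_derivative
         (g \<xi> / \<xi> * (mixture a \<nu> \<xi> * \<xi> ^ i) - f \<xi> * ((- 2 * a) * \<xi> * mixture a (\<nu> + 1) \<xi> * \<xi> ^ i + (real i * \<xi> ^ (i - Suc 0)) * mixture a \<nu> \<xi>))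
           / (mixture a \<nu> \<xi> * \<xi> ^ i * (mixture a \<nu> \<xi> * \<xi> ^ i))) (at \<xi>)"
        by (rule DERIV_divide[OF g(2)[OF \<xi>] DERIV_mult[OF mixture_has_derivative[OF a \<xi>] DERIV_pow]])
           (use pos \<xi> in auto)
      have "(g \<xi> / \<xi> * (mixture a \<nu> \<xi> * \<xi> ^ i) - f \<xi> * ((- 2 * a) * \<xi> * mixture a (\<nu> + 1) \<xi> * \<xi> ^ i + (real i * \<xi> ^ (i - Suc 0)) * mixture a \<nu> \<xi>))
           / (mixture a \<nu> \<xi> * \<xi> ^ i * (mixture a \<nu> \<xi> * \<xi> ^ i)) = ?F' \<xi>"
      proof -
        have "(G / x * (w * X) - F * ((- 2 * a) * x * D * X + (k * X / x) * w)) / (w * X * (w * X)) =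
           ((G + (2 * a) * (x\<^sup>2 * D / w * F)) + (- k) * F) / (w * (x * X))"
          if "x \<noteq> 0" "w \<noteq> 0" "X \<noteq> 0" for k X F G D w x :: real
          using that by (simp add: divide_simps) (simp add: algebra_simps power2_eq_square)
        from this[OF \<xi> pos, of "\<xi> ^ i"] \<xi> show ?thesis unfolding pw by simp
      qed
      with D have "((\<lambda>\<xi>. f \<xi> / (mixture a \<nu> \<xi> * \<xi> ^ i)) has_real_derivative ?F' \<xi>) (at \<xi>)"
        by simp
      then show ?thesis
        by (rule has_field_derivative_transform_within_open[where S="- {0}"]) (use \<xi> in auto)
    qed
    obtain C where C: "\<And>\<xi>. \<xi> \<in> {-4<..<4} - {0} \<Longrightarrow> \<bar>f \<xi> / (mixture a \<nu> \<xi> * \<xi> ^ i)\<bar> \<le> C"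
      using bound0[OF Suc.prems(1), of i] Suc.prems(2) by (auto simp del: Diff_iff)
    have cont: "isCont ?F \<xi>" for \<xi>
    proof (cases "\<xi> = 0")
      case False
      then show ?thesis using DERIV_isCont[OF der] by blast
    next
      case True
      obtain C where C: "\<And>\<xi>. \<xi> \<in> {-4<..<4} - {0} \<Longrightarrow> \<bar>f \<xi> / (mixture a \<nu> \<xi> * \<xi> ^ i)\<bar> \<le> C * \<bar>\<xi>\<bar> powr (2 * \<nu> - real i)"
        using bound[OF Suc.prems(1)] by blast
      have "\<bar>?F \<xi>\<bar> \<le> C * \<bar>\<xi>\<bar> powr (2 * \<nu> - real i)" if "\<xi> \<noteq> 0" "\<bar>\<xi>\<bar> < 1" for \<xi>
        using C[of \<xi>] that by (auto simp: abs_less_iff)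
      then have "(?F \<longlongrightarrow> 0) (at 0)"
        by (rule tendsto_0_of_powr_bound) (use Suc.prems in auto)
      then show ?thesis using True by (simp add: isCont_def)
    qed
    have "continuous_on {-4<..<4} ?F" by (intro continuous_at_imp_continuous_on ballI cont)
    moreover have "\<bar>?F \<xi>\<bar> \<le> C" "\<xi> \<noteq> 0" if "\<xi> \<in> {-4<..<4} - {0}" for \<xi>
      using C[OF that] that by auto
    ultimately show ?case
      using bdd_derivs_SucI[OF _ _ der F'] by blast
  }
qed

section \<open>The periodised mixture near 0\<close>

text \<open>The periodisation without the only term that can be singular on the window; what remains
  is smooth there.\<close>

definition tail_sum :: "real \<Rightarrow> real \<Rightarrow> real" where
  "tail_sum \<nu> \<xi> = (\<Sum>\<^sub>\<infinity>j\<in>- {0::int}. mixture a \<nu> (\<xi> + 2 * pi * of_int j))"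

lemma tail_sum_nonneg: "0 \<le> tail_sum \<nu> \<xi>"
  unfolding tail_sum_def by (intro infsum_nonneg mixture_nonneg[OF a])

lemma bdd_derivs_tail_sum: "bdd_derivs {-4<..<4} {0} n (tail_sum \<nu>)"
proof -
  obtain C where C: "\<And>j::int. j \<noteq> 0 \<Longrightarrow> bounded_derivs {-4<..<4} {} n (C / (real_of_int j)\<^sup>2)
     (\<lambda>\<xi>. mixture a \<nu> (\<xi> + 2 * pi * of_int j))"
    using bounded_derivs_mixture_shift[OF a, of n 0 \<nu>] by auto
  have "bounded_derivs {-4<..<4} {} n (\<Sum>\<^sub>\<infinity>j\<in>- {0::int}. C / (real_of_int j)\<^sup>2)
      (\<lambda>\<xi>. \<Sum>\<^sub>\<infinity>j\<in>- {0::int}. mixture a \<nu> (\<xi> + 2 * pi * of_int j))"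
    by (rule bounded_derivs_infsum[OF _ summable_on_int_inverse_square]) (use C in auto)
  from bdd_derivsI[OF bounded_derivs_subset_exceptions[OF this]] show ?thesis
    unfolding tail_sum_def[abs_def] .
qed

lemma infsum_mixture_shift:
  assumes "\<bar>\<xi>\<bar> < 4"
  shows "(\<Sum>\<^sub>\<infinity>j\<in>(UNIV::int set). mixture a \<nu> (\<xi> + 2 * pi * of_int j)) = mixture a \<nu> \<xi> + tail_sum \<nu> \<xi>"
proof -
  obtain C where C: "\<And>j::int. j \<noteq> 0 \<Longrightarrow> bounded_derivs {-4<..<4} {} 0 (C / (real_of_int j)\<^sup>2)
     (\<lambda>\<xi>. mixture a \<nu> (\<xi> + 2 * pi * of_int j))"
    using bounded_derivs_mixture_shift[OF a, of 0 0 \<nu>] by auto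
  have "(\<lambda>j::int. mixture a \<nu> (\<xi> + 2 * pi * of_int j)) summable_on (- {0})"
    by (rule summable_on_comparison_test[OF summable_on_int_inverse_square[of C]])
       (use C assms mixture_nonneg[OF a] in \<open>auto simp: abs_less_iff abs_le_iff\<close>)
  then have "(\<Sum>\<^sub>\<infinity>j\<in>insert 0 (- {0::int}). mixture a \<nu> (\<xi> + 2 * pi * of_int j)) =
      mixture a \<nu> (\<xi> + 2 * pi * of_int 0) + (\<Sum>\<^sub>\<infinity>j\<in>- {0::int}. mixture a \<nu> (\<xi> + 2 * pi * of_int j))"
    by (intro infsum_insert) auto
  moreover have "insert 0 (- {0::int}) = UNIV" by auto
  ultimately show ?thesis by (simp add: tail_sum_def)
qed

text \<open>
  For \<open>\<nu> > 0\<close> both functions are written through \<open>r = 1 / mixture a \<nu>\<close>, which is regular at 0, as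
  \<open>r / (1 + r * tail_sum \<nu>)\<close> and \<open>1 / (1 + r * tail_sum \<nu>)\<close>. In the borderline
  case \<open>n = 2 * \<nu>\<close> the size estimate only shows that the last derivative of \<open>r\<close> is bounded near 0.
\<close>

lemma local_quotient:
  assumes "(\<nu> > 0 \<and> real n \<le> 2 * \<nu>) \<or> (\<nu> < 0 \<and> real n < - 2 * \<nu>)"
  obtains T T0 where "bdd_derivs {-4<..<4} {0} n T" "bdd_derivs {-4<..<4} {0} n T0"
    "\<And>\<xi>. \<xi> \<in> {-4<..<4} - {0} \<Longrightarrow> T \<xi> = 1 / (mixture a \<nu> \<xi> + tail_sum \<nu> \<xi>)"
    "\<And>\<xi>. \<xi> \<in> {-4<..<4} - {0} \<Longrightarrow> T0 \<xi> = mixture a \<nu> \<xi> / (mixture a \<nu> \<xi> + tail_sum \<nu> \<xi>)"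
  using assms
proof (elim disjE conjE)
  assume \<nu>: "\<nu> > 0" "real n \<le> 2 * \<nu>"
  \<comment> \<open>The trivial factor \<open>\<xi> ^ 0\<close> fits the case i = 0, f = 1 of
    \<open>bdd_derivs_euler_algebra\<close>.\<close>
  define r where "r = (\<lambda>\<xi>. if \<xi> = 0 then 0 else 1 / (mixture a \<nu> \<xi> * \<xi> ^ 0))"
  have r: "bdd_derivs {-4<..<4} {0} n r"
    unfolding r_def by (rule bdd_derivs_euler_algebra[OF \<nu>(1) euler_algebra.const]) (use \<nu> in simp)
  have r0: "r \<xi> \<ge> 0" for \<xi> using mixture_nonneg[OF a, of \<nu> \<xi>] by (simp add: r_def)
  define T0 where "T0 = (\<lambda>\<xi>. 1 / (1 + r \<xi> * tail_sum \<nu> \<xi>))"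
  have T0: "bdd_derivs {-4<..<4} {0} n T0"
    unfolding T0_def
    by (rule bdd_derivs_inverse[where \<delta>=1])
       (use r0 tail_sum_nonneg in \<open>auto intro!: bdd_derivs_add bdd_derivs_mult bdd_derivs_const r bdd_derivs_tail_sum\<close>)
  have *: "r \<xi> * T0 \<xi> = 1 / (mixture a \<nu> \<xi> + tail_sum \<nu> \<xi>)" "T0 \<xi> = mixture a \<nu> \<xi> / (mixture a \<nu> \<xi> + tail_sum \<nu> \<xi>)"
    if "\<xi> \<in> {-4<..<4} - {0}" for \<xi>
  proof -
    have "mixture a \<nu> \<xi> > 0" using mixture_pos[OF a, of \<xi> \<nu>] that by simp
    moreover from this have "mixture a \<nu> \<xi> + tail_sum \<nu> \<xi> > 0" using tail_sum_nonneg[of \<nu> \<xi>] by linarith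
    ultimately show "r \<xi> * T0 \<xi> = 1 / (mixture a \<nu> \<xi> + tail_sum \<nu> \<xi>)" "T0 \<xi> = mixture a \<nu> \<xi> / (mixture a \<nu> \<xi> + tail_sum \<nu> \<xi>)"
      using that by (auto simp: r_def T0_def field_simps)
  qed
  show ?thesis
    by (rule that[of "\<lambda>\<xi>. r \<xi> * T0 \<xi>" T0]) (use * T0 bdd_derivs_mult[OF r T0] in auto)
next
  assume \<nu>: "\<nu> < 0" "real n < - 2 * \<nu>"
  have w: "bdd_derivs {-4<..<4} {0} n (mixture a \<nu>)"
    using bdd_derivs_mixture_neg[OF a, of n 0 \<nu>] \<nu> by simp
  define T where "T = (\<lambda>\<xi>. 1 / (mixture a \<nu> \<xi> + tail_sum \<nu> \<xi>))"
  \<comment> \<open>For \<nu> < 0 the mixture is finite at 0 and decreasing in \<bar>\<xi>\<bar>, so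
    its value at the window edge bounds the denominator from below.\<close>
  have low: "mixture a \<nu> 4 \<le> mixture a \<nu> \<xi> + tail_sum \<nu> \<xi>" if "\<xi> \<in> {-4<..<4}" for \<xi>
    using mixture_antimono[OF a, of \<xi> 4 \<nu>] tail_sum_nonneg[of \<nu> \<xi>] \<nu> that by (auto simp: abs_le_iff)
  have T: "bdd_derivs {-4<..<4} {0} n T"
    unfolding T_def
    by (rule bdd_derivs_inverse[OF mixture_pos[OF a] low bdd_derivs_add[OF w bdd_derivs_tail_sum]]) auto
  show ?thesis
    by (rule that[OF T bdd_derivs_mult[OF w T]]) (auto simp: T_def)
qed

end

section \<open>Decay of Fourier integrals\<close>

definition two_pi_lattice :: "real set" where
  "two_pi_lattice = range (\<lambda>j::int. 2 * pi * of_int j)"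

definition nearest :: "real \<Rightarrow> int" where
  "nearest \<eta> = round (\<eta> / (2 * pi))"

lemma countable_two_pi_lattice: "countable two_pi_lattice"
  unfolding two_pi_lattice_def by (rule countable_image) simp

lemma finite_two_pi_lattice_Icc: "finite (two_pi_lattice \<inter> {a..b})"
proof -
  have "{j::int. 2 * pi * of_int j \<in> {a..b}} \<subseteq> {\<lfloor>a / (2 * pi)\<rfloor>..\<lceil>b / (2 * pi)\<rceil>}"
    using pi_gt_zero by (auto simp: floor_le_iff le_ceiling_iff divide_simps mult.commute)
       (simp_all add: distrib_right left_diff_distrib, (use pi_gt_zero in linarith)+)
  then have "finite {j::int. 2 * pi * of_int j \<in> {a..b}}"
    by (rule finite_subset) simp
  then have "finite ((\<lambda>j::int. 2 * pi * of_int j) ` {j::int. 2 * pi * of_int j \<in> {a..b}})"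
    by (rule finite_imageI)
  moreover have "two_pi_lattice \<inter> {a..b} \<subseteq> (\<lambda>j::int. 2 * pi * of_int j) ` {j::int. 2 * pi * of_int j \<in> {a..b}}"
    by (auto simp: two_pi_lattice_def)
  ultimately show ?thesis by (rule finite_subset[rotated])
qed

lemma nearest_bound: "\<bar>\<eta> - 2 * pi * of_int (nearest \<eta>)\<bar> \<le> pi"
proof -
  have "\<bar>of_int (nearest \<eta>) - \<eta> / (2 * pi)\<bar> \<le> 1 / 2"
    unfolding nearest_def by (rule of_int_round_abs_le)
  then have "2 * pi * \<bar>of_int (nearest \<eta>) - \<eta> / (2 * pi)\<bar> \<le> 2 * pi * (1 / 2)"
    by (intro mult_left_mono) auto
  also have "2 * pi * \<bar>of_int (nearest \<eta>) - \<eta> / (2 * pi)\<bar> = \<bar>2 * pi * (of_int (nearest \<eta>) - \<eta> / (2 * pi))\<bar>"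
    by (simp add: abs_mult)
  finally show ?thesis by (simp add: algebra_simps abs_minus_commute)
qed

lemma nearest_two_pi_lattice: "nearest (2 * pi * of_int j) = j"
  by (simp add: nearest_def)

lemma shift_notin_two_pi_lattice:
  assumes "\<bar>\<xi>\<bar> < 4" "\<xi> \<noteq> 0"
  shows "\<xi> + 2 * pi * of_int j \<notin> two_pi_lattice"
proof
  assume "\<xi> + 2 * pi * of_int j \<in> two_pi_lattice"
  then obtain i where i: "\<xi> + 2 * pi * of_int j = 2 * pi * real_of_int i" by (auto simp: two_pi_lattice_def)
  then have "\<xi> + 2 * pi * of_int (j - i) = 0" by (simp add: algebra_simps)
  moreover from this assms(2) have "j - i \<noteq> 0" by auto
  ultimately show False using abs_shift_ge[OF assms(1), of "j - i"] by auto
qed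

text \<open>
  The window \<open>(-4, 4)\<close> is longer than a period, and overlapping windows share no point of the lattice
  because \<open>pi < 4 < 2 * pi\<close>; so the local derivatives agree on overlaps by uniqueness.
\<close>

lemma bounded_derivs_glue:
  assumes "\<And>j::int. bounded_derivs {-4<..<4} {0} n (M j) (\<lambda>\<xi>. f (\<xi> + 2 * pi * of_int j))"
  shows "\<exists>F. F 0 = f \<and> (\<forall>i<n. continuous_on UNIV (F i)) \<and>
    (\<forall>i<n. \<forall>\<eta>. \<eta> \<notin> two_pi_lattice \<longrightarrow> (F i has_real_derivative F (Suc i) \<eta>) (at \<eta>)) \<and>
    (\<forall>i\<le>n. \<forall>\<eta>. \<eta> \<notin> two_pi_lattice \<longrightarrow> \<bar>F i \<eta>\<bar> \<le> M (nearest \<eta>))"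
  using assms
proof (induction n arbitrary: f)
  have near: "\<eta> - 2 * pi * of_int (nearest \<eta>) \<in> {-4<..<4}" for \<eta>
    using nearest_bound[of \<eta>] pi_less_4 by (auto simp: abs_le_iff)
  have near0: "\<eta> - 2 * pi * of_int (nearest \<eta>) \<in> {-4<..<4} - {0}" if "\<eta> \<notin> two_pi_lattice" for \<eta>
    using near[of \<eta>] that by (auto simp: two_pi_lattice_def)
  have fb: "\<bar>f \<eta>\<bar> \<le> M (nearest \<eta>)"
    if "\<And>j::int. bounded_derivs {-4<..<4} {0} n (M j) (\<lambda>\<xi>. f (\<xi> + 2 * pi * of_int j))" "\<eta> \<notin> two_pi_lattice" for f n \<eta>
    using bounded_derivs_bound[OF that(1)[of "nearest \<eta>"] near0[OF that(2)]] by simp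
  {
    case 0
    then show ?case using fb[of 0 f] by (intro exI[of _ "\<lambda>_. f"]) simp
  next
    case (Suc n)
    have "\<forall>j. \<exists>f'. (\<forall>\<xi>\<in>{-4<..<4} - {0}. ((\<lambda>\<xi>. f (\<xi> + 2 * pi * of_int j)) has_real_derivative f' \<xi>) (at \<xi>)) \<and>
        bounded_derivs {-4<..<4} {0} n (M j) f'"
      using Suc.prems by simp
    from choice[OF this] obtain f' where f'0:
      "\<forall>j. (\<forall>\<xi>\<in>{-4<..<4} - {0}. ((\<lambda>\<xi>. f (\<xi> + 2 * pi * of_int j)) has_real_derivative f' j \<xi>) (at \<xi>)) \<and>
        bounded_derivs {-4<..<4} {0} n (M j) (f' j)"
      by (elim exE)
    have f': "((\<lambda>\<xi>. f (\<xi> + 2 * pi * of_int j)) has_real_derivative f' j \<xi>) (at \<xi>)" if "\<xi> \<in> {-4<..<4} - {0}" for j \<xi>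
      using f'0[THEN spec, of j, THEN conjunct1] that by (rule bspec)
    have f'b: "bounded_derivs {-4<..<4} {0} n (M j) (f' j)" for j
      using f'0[THEN spec, of j] by (rule conjunct2)
    have der: "(f has_real_derivative f' j \<xi>) (at (\<xi> + 2 * pi * of_int j))" if "\<xi> \<in> {-4<..<4} - {0}" for j \<xi>
      using f'[OF that] by (simp only: DERIV_shift)
    define g where "g \<eta> = f' (nearest \<eta>) (\<eta> - 2 * pi * of_int (nearest \<eta>))" for \<eta>
    have gder: "(f has_real_derivative g \<eta>) (at \<eta>)" if "\<eta> \<notin> two_pi_lattice" for \<eta>
      using der[OF near0[OF that], of "nearest \<eta>"] by (simp add: g_def)
    \<comment> \<open>Differentiability does not determine \<open>f' j 0\<close>. It agrees with
      \<open>g\<close> because \<open>nearest\<close> sends a lattice point to its own index;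
      continuity across the lattice thus carries over to \<open>g\<close>.\<close>
    have g_eq: "f' j \<xi> = g (\<xi> + 2 * pi * of_int j)" if \<xi>: "\<xi> \<in> {-4<..<4}" for j \<xi>
    proof (cases "\<xi> = 0")
      case True
      then show ?thesis by (simp add: g_def nearest_two_pi_lattice)
    next
      case False
      have "\<xi> + 2 * pi * of_int j \<notin> two_pi_lattice"
        by (rule shift_notin_two_pi_lattice) (use \<xi> False in auto)
      from DERIV_unique[OF der gder[OF this]] show ?thesis using \<xi> False by simp
    qed
    have "bounded_derivs {-4<..<4} {0} n (M j) (\<lambda>\<xi>. g (\<xi> + 2 * pi * of_int j))" for j
      by (rule bounded_derivs_cong[OF f'b _ g_eq]) auto
    from Suc.IH[OF this] obtain G where G: "G 0 = g" "\<forall>i<n. continuous_on UNIV (G i)"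
      "\<forall>i<n. \<forall>\<eta>. \<eta> \<notin> two_pi_lattice \<longrightarrow> (G i has_real_derivative G (Suc i) \<eta>) (at \<eta>)"
      "\<forall>i\<le>n. \<forall>\<eta>. \<eta> \<notin> two_pi_lattice \<longrightarrow> \<bar>G i \<eta>\<bar> \<le> M (nearest \<eta>)"
      by auto
    define F where "F = case_nat f G"
    have "isCont f \<eta>" for \<eta>
    proof -
      have "continuous_on {-4<..<4} (\<lambda>\<xi>. f (\<xi> + 2 * pi * of_int (nearest \<eta>)))"
        using Suc.prems[of "nearest \<eta>"] by simp
      then have "isCont (\<lambda>\<xi>. f (\<xi> + 2 * pi * of_int (nearest \<eta>))) (\<eta> - 2 * pi * of_int (nearest \<eta>))"
        using near[of \<eta>] by (simp add: continuous_on_eq_continuous_at)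
      from isCont_o2[where f="\<lambda>y. y - 2 * pi * of_int (nearest \<eta>)", OF _ this] show ?thesis by simp
    qed
    then have "continuous_on UNIV f" by (simp add: continuous_at_imp_continuous_on)
    then have "\<forall>i<Suc n. continuous_on UNIV (F i)"
      using G(2) by (auto simp: F_def split: nat.split)
    moreover have "\<forall>i<Suc n. \<forall>\<eta>. \<eta> \<notin> two_pi_lattice \<longrightarrow> (F i has_real_derivative F (Suc i) \<eta>) (at \<eta>)"
      using G(1,3) gder by (auto simp: F_def split: nat.split)
    moreover have "\<forall>i\<le>Suc n. \<forall>\<eta>. \<eta> \<notin> two_pi_lattice \<longrightarrow> \<bar>F i \<eta>\<bar> \<le> M (nearest \<eta>)"
      using G(4) fb[of "Suc n" f, OF Suc.prems] by (auto simp: F_def split: nat.split)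
    moreover have "F 0 = f" by (simp add: F_def)
    ultimately show ?case by blast
  }
qed

section \<open>Repeated integration by parts\<close>

text \<open>With the gauge integral, the fundamental theorem delivers integrability of the
  derivative as part of its conclusion and tolerates finitely many exceptional points.\<close>

lemma integral_by_parts_exp:
  fixes f f' :: "real \<Rightarrow> real" and x N :: real
  assumes S: "finite S" and N: "0 \<le> N"
    and cont: "continuous_on UNIV f"
    and der: "\<And>\<eta>. \<eta> \<in> {-N..N} - S \<Longrightarrow> (f has_real_derivative f' \<eta>) (at \<eta>)"
  defines "e \<equiv> \<lambda>\<eta>::real. exp (\<i> * of_real x * of_real \<eta>)"
  shows "(\<lambda>\<eta>. of_real (f' \<eta>) * e \<eta>) integrable_on {-N..N}"
    and "integral {-N..N} (\<lambda>\<eta>. of_real (f' \<eta>) * e \<eta>) =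
      (of_real (f N) * e N - of_real (f (- N)) * e (- N)) - \<i> * of_real x * integral {-N..N} (\<lambda>\<eta>. of_real (f \<eta>) * e \<eta>)"
proof -
  let ?b = "of_real (f N) * e N - of_real (f (- N)) * e (- N)"
  have c: "continuous_on A (\<lambda>\<eta>. complex_of_real (f \<eta>) * e \<eta>)" for A
    unfolding e_def by (intro continuous_intros continuous_on_subset[OF cont]) auto
  have e': "(e has_vector_derivative \<i> * of_real x * e \<eta>) (at \<eta>)" for \<eta>
    unfolding e_def
    by (rule has_vector_derivative_real_field) (auto intro!: derivative_eq_intros)
  have "((\<lambda>\<eta>. of_real (f \<eta>) * (\<i> * of_real x * e \<eta>) + of_real (f' \<eta>) * e \<eta>) has_integral ?b) {-N..N}"
  proof (rule fundamental_theorem_of_calculus_strong[OF S])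
    show "((\<lambda>\<eta>. complex_of_real (f \<eta>) * e \<eta>) has_vector_derivative of_real (f \<eta>) * (\<i> * of_real x * e \<eta>) + of_real (f' \<eta>) * e \<eta>) (at \<eta>)"
      if "\<eta> \<in> {-N..N} - S" for \<eta>
      by (rule has_vector_derivative_mult[OF _ e'])
         (use der[OF that] in \<open>auto intro: has_vector_derivative_of_real simp: has_real_derivative_iff_has_vector_derivative\<close>)
  qed (use N c in auto)
  moreover have int: "(\<lambda>\<eta>. of_real (f \<eta>) * e \<eta>) integrable_on {-N..N}"
    by (rule integrable_continuous_real[OF c])
  from has_integral_mult_right[OF integrable_integral[OF int], of "\<i> * of_real x"]
  have "((\<lambda>\<eta>. of_real (f \<eta>) * (\<i> * of_real x * e \<eta>)) has_integral \<i> * of_real x * integral {-N..N} (\<lambda>\<eta>. of_real (f \<eta>) * e \<eta>)) {-N..N}"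
    by (simp add: mult.left_commute mult.assoc)
  ultimately have "((\<lambda>\<eta>. of_real (f \<eta>) * (\<i> * of_real x * e \<eta>) + of_real (f' \<eta>) * e \<eta> - of_real (f \<eta>) * (\<i> * of_real x * e \<eta>))
     has_integral ?b - \<i> * of_real x * integral {-N..N} (\<lambda>\<eta>. of_real (f \<eta>) * e \<eta>)) {-N..N}"
    by (rule has_integral_diff)
  then have "((\<lambda>\<eta>. of_real (f' \<eta>) * e \<eta>)
     has_integral ?b - \<i> * of_real x * integral {-N..N} (\<lambda>\<eta>. of_real (f \<eta>) * e \<eta>)) {-N..N}"
    by simp
  then show "(\<lambda>\<eta>. of_real (f' \<eta>) * e \<eta>) integrable_on {-N..N}"
    and "integral {-N..N} (\<lambda>\<eta>. of_real (f' \<eta>) * e \<eta>) = ?b - \<i> * of_real x * integral {-N..N} (\<lambda>\<eta>. of_real (f \<eta>) * e \<eta>)"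
    by (auto simp: has_integral_integrable_integral)
qed

lemma integrable_quadratic_decay:
  fixes f :: "real \<Rightarrow> real"
  assumes "continuous_on UNIV f" "\<And>\<eta>. \<eta> \<notin> two_pi_lattice \<Longrightarrow> \<bar>f \<eta>\<bar> \<le> D / (1 + \<eta>\<^sup>2)"
  shows "integrable lborel f"
proof (rule Bochner_Integration.integrable_bound[OF integrable_mult_right[OF integrable_inverse_1_plus_square, of D]])
  show "f \<in> borel_measurable lborel"
    using borel_measurable_continuous_onI[OF assms(1)] by simp
  have "AE \<eta> in lborel. \<eta> \<notin> two_pi_lattice"
    by (rule AE_not_in[OF countable_imp_null_set_lborel[OF countable_two_pi_lattice]])
  then show "AE \<eta> in lborel. norm (f \<eta>) \<le> norm (D * (1 / (1 + \<eta>\<^sup>2)))"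
  proof eventually_elim
    case (elim \<eta>)
    show ?case using order_trans[OF assms(2)[OF elim] abs_ge_self] by simp
  qed
qed

text \<open>Integration by parts takes place on [-R, R]. The quadratic decay removes the boundary
  terms as R grows and bounds the last integral by D times pi, the integral of 1 / (1 +
  \<eta>^2).\<close>

lemma fourier_integral_decay:
  fixes F :: "nat \<Rightarrow> real \<Rightarrow> real" and x :: real
  assumes n: "n \<ge> 1" and x: "\<bar>x\<bar> \<ge> 1" and D: "D \<ge> 0"
    and cont: "\<And>i. i < n \<Longrightarrow> continuous_on UNIV (F i)"
    and der: "\<And>i \<eta>. i < n \<Longrightarrow> \<eta> \<notin> two_pi_lattice \<Longrightarrow> (F i has_real_derivative F (Suc i) \<eta>) (at \<eta>)"
    and bound: "\<And>i \<eta>. i \<le> n \<Longrightarrow> \<eta> \<notin> two_pi_lattice \<Longrightarrow> \<bar>F i \<eta>\<bar> \<le> D / (1 + \<eta>\<^sup>2)"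
  shows "norm (LINT \<eta>|lborel. of_real (F 0 \<eta>) * exp (\<i> * of_real x * of_real \<eta>)) \<le> pi * D / \<bar>x\<bar> ^ n"
proof -
  define e where "e \<eta> = exp (\<i> * of_real x * complex_of_real \<eta>)" for \<eta>
  have e1: "norm (e \<eta>) = 1" for \<eta> by (simp add: e_def)
  \<comment> \<open>Odd multiples of pi lie midway between lattice points, so the pointwise bounds
    hold at the end points.\<close>
  define R where "R m = (2 * real m + 1) * pi" for m :: nat
  have R0: "0 \<le> R m" for m by (simp add: R_def)
  \<comment> \<open>A crude bound suffices: it only has to make the boundary terms vanish in the
    limit.\<close>
  have Rm: "real (Suc m) \<le> 1 + (R m)\<^sup>2" for m
  proof -
    have "1 * 1 \<le> (2 * real m + 1) * pi" using pi_gt3 by (intro mult_mono) auto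
    then have "R m \<ge> 1" by (simp add: R_def)
    moreover have "real m \<le> (2 * real m + 1) * pi" using pi_gt3 mult_mono[of "real m" "2 * real m + 1" 1 pi] by simp
    then have "real m \<le> R m" by (simp add: R_def)
    ultimately have "real m * 1 \<le> R m * R m" by (intro mult_mono) auto
    then show ?thesis by (simp add: power2_eq_square)
  qed
  have RL: "R m \<notin> two_pi_lattice" "- R m \<notin> two_pi_lattice" for m
  proof -
    have "(2 * real m + 1) * pi \<noteq> 2 * pi * real_of_int j" "- ((2 * real m + 1) * pi) \<noteq> 2 * pi * real_of_int j" for j :: int
    proof -
      have ne: "2 * int m + 1 \<noteq> 2 * j" "- (2 * int m + 1) \<noteq> 2 * j" by presburger+
      have e: "(2 * real m + 1) * pi = pi * real_of_int (2 * int m + 1)"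
        "- ((2 * real m + 1) * pi) = pi * real_of_int (- (2 * int m + 1))"
        "2 * pi * real_of_int j = pi * real_of_int (2 * j)"
        by (simp_all add: algebra_simps)
      show "(2 * real m + 1) * pi \<noteq> 2 * pi * real_of_int j"
        unfolding e(1,3) mult_cancel_left of_int_eq_iff using ne(1) by simp
      show "- ((2 * real m + 1) * pi) \<noteq> 2 * pi * real_of_int j"
        unfolding e(2,3) mult_cancel_left of_int_eq_iff using ne(2) by simp
    qed
    then show "R m \<notin> two_pi_lattice" "- R m \<notin> two_pi_lattice" by (auto simp: R_def two_pi_lattice_def)
  qed
  define J where "J i m = integral {- R m..R m} (\<lambda>\<eta>. of_real (F i \<eta>) * e \<eta>)" for i m
  have parts: "(\<lambda>\<eta>. of_real (F (Suc i) \<eta>) * e \<eta>) integrable_on {- R m..R m}"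
     "J (Suc i) m = (of_real (F i (R m)) * e (R m) - of_real (F i (- R m)) * e (- R m)) - \<i> * of_real x * J i m"
    if "i < n" for i m
  proof -
    have d: "(F i has_real_derivative F (Suc i) \<eta>) (at \<eta>)" if "\<eta> \<in> {- R m..R m} - two_pi_lattice \<inter> {- R m..R m}" for \<eta>
      by (rule der[OF \<open>i < n\<close>]) (use that in blast)
    show "(\<lambda>\<eta>. of_real (F (Suc i) \<eta>) * e \<eta>) integrable_on {- R m..R m}"
      "J (Suc i) m = (of_real (F i (R m)) * e (R m) - of_real (F i (- R m)) * e (- R m)) - \<i> * of_real x * J i m"
      unfolding J_def e_def
      by (rule integral_by_parts_exp[OF finite_two_pi_lattice_Icc R0 cont[OF that] d], assumption)+
  qed
  have step: "norm (J i m) \<le> norm (J (Suc i) m) / \<bar>x\<bar> + 2 * D / real (Suc m)" if "i < n" for i m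
  proof -
    have b: "norm (of_real (F i \<eta>) * e \<eta>) \<le> D / real (Suc m)" if "\<eta> \<in> {R m, - R m}" for \<eta>
    proof -
      have "\<bar>F i \<eta>\<bar> \<le> D / (1 + \<eta>\<^sup>2)"
        using bound[of i \<eta>] \<open>i < n\<close> that RL by auto
      also have "\<dots> = D / (1 + (R m)\<^sup>2)" using that by auto
      also have "\<dots> \<le> D / real (Suc m)"
        using Rm[of m] D by (intro divide_left_mono mult_pos_pos) (auto simp: add_pos_nonneg)
      finally show ?thesis by (simp add: norm_mult e1)
    qed
    have "\<bar>x\<bar> * norm (J i m) = norm (\<i> * of_real x * J i m)" by (simp add: norm_mult)
    also have "\<i> * of_real x * J i m = (of_real (F i (R m)) * e (R m) - of_real (F i (- R m)) * e (- R m)) - J (Suc i) m"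
      using parts(2)[OF that, of m] by simp
    also have "norm \<dots> \<le> norm (of_real (F i (R m)) * e (R m)) + norm (of_real (F i (- R m)) * e (- R m)) + norm (J (Suc i) m)"
      by (rule order_trans[OF norm_triangle_ineq4 add_right_mono[OF norm_triangle_ineq4]])
    also have "\<dots> \<le> D / real (Suc m) + D / real (Suc m) + norm (J (Suc i) m)"
      by (intro add_mono b) auto
    finally have "\<bar>x\<bar> * norm (J i m) \<le> 2 * D / real (Suc m) + norm (J (Suc i) m)" by simp
    then have "norm (J i m) \<le> (2 * D / real (Suc m) + norm (J (Suc i) m)) / \<bar>x\<bar>"
      using x by (simp add: pos_le_divide_eq mult.commute)
    also have "\<dots> = 2 * D / real (Suc m) / \<bar>x\<bar> + norm (J (Suc i) m) / \<bar>x\<bar>"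
      by (rule add_divide_distrib)
    also have "2 * D / real (Suc m) / \<bar>x\<bar> \<le> 2 * D / real (Suc m) / 1"
      using x D by (intro divide_left_mono) auto
    finally show ?thesis by simp
  qed
  have iter: "norm (J 0 m) \<le> norm (J i m) / \<bar>x\<bar> ^ i + real i * (2 * D / real (Suc m))" if "i \<le> n" for i m
    using that
  proof (induction i)
    case 0
    then show ?case by simp
  next
    case (Suc i)
    have xi: "\<bar>x\<bar> ^ i \<ge> 1" using x by (rule one_le_power)
    have "norm (J i m) / \<bar>x\<bar> ^ i \<le> (norm (J (Suc i) m) / \<bar>x\<bar> + 2 * D / real (Suc m)) / \<bar>x\<bar> ^ i"
      using step[of i m] Suc.prems by (intro divide_right_mono) auto
    also have "\<dots> = norm (J (Suc i) m) / \<bar>x\<bar> ^ Suc i + 2 * D / real (Suc m) / \<bar>x\<bar> ^ i"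
      by (simp add: add_divide_distrib)
    also have "2 * D / real (Suc m) / \<bar>x\<bar> ^ i \<le> 2 * D / real (Suc m) / 1"
      using xi D x by (intro divide_left_mono) auto
    finally show ?case using Suc by (simp add: algebra_simps add_divide_distrib)
  qed
  have Jn: "norm (J n m) \<le> pi * D" for m
  proof -
    \<comment> \<open>\<open>F n\<close> is bounded only off the lattice; clearing it on this null
      set gives a bound at every point without changing the integral.\<close>
    define G where "G \<eta> = (if \<eta> \<in> two_pi_lattice then 0 else complex_of_real (F n \<eta>) * e \<eta>)" for \<eta>
    have neg: "negligible two_pi_lattice" using countable_imp_null_set_lborel[OF countable_two_pi_lattice] by (simp add: negligible_iff_null_sets null_sets_completionI)
    have "(\<lambda>\<eta>. of_real (F n \<eta>) * e \<eta>) integrable_on {- R m..R m}"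
      using parts(1)[of "n - 1" m] n by simp
    then have Gi: "G integrable_on {- R m..R m}"
      by (rule integrable_spike[OF _ neg]) (auto simp: G_def)
    have JG: "J n m = integral {- R m..R m} G"
      unfolding J_def by (rule integral_spike[OF neg]) (auto simp: G_def)
    have A: "((\<lambda>\<eta>. D * (1 / (1 + \<eta>\<^sup>2))) has_integral D * (arctan (R m) - arctan (- R m))) {- R m..R m}"
      by (intro has_integral_mult_right fundamental_theorem_of_calculus)
         (auto simp: R0 has_real_derivative_iff_has_vector_derivative[symmetric] inverse_eq_divide
            intro!: derivative_eq_intros)
    have "norm (J n m) \<le> integral {- R m..R m} (\<lambda>\<eta>. D * (1 / (1 + \<eta>\<^sup>2)))"
      unfolding JG
      by (rule Henstock_Kurzweil_Integration.integral_norm_bound_integral[OF Gi has_integral_integrable[OF A]])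
         (use bound[of n] D in \<open>auto simp: G_def norm_mult e1\<close>)
    also have "\<dots> = D * (arctan (R m) - arctan (- R m))"
      using A by (rule integral_unique)
    also have "\<dots> \<le> D * pi"
      using arctan_bounded[of "R m"] D by (intro mult_left_mono) (auto simp: arctan_minus)
    finally show ?thesis by (simp add: mult.commute)
  qed
  have int: "integrable lborel (\<lambda>\<eta>. complex_of_real (F 0 \<eta>) * e \<eta>)"
  proof (rule Bochner_Integration.integrable_bound[OF integrable_quadratic_decay])
    show "continuous_on UNIV (F 0)" using cont n by simp
    show "\<bar>F 0 \<eta>\<bar> \<le> D / (1 + \<eta>\<^sup>2)" if "\<eta> \<notin> two_pi_lattice" for \<eta> using bound that by simp
    have "continuous_on UNIV (\<lambda>\<eta>. complex_of_real (F 0 \<eta>) * e \<eta>)"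
      unfolding e_def using cont[of 0] n by (intro continuous_intros) auto
    then show "(\<lambda>\<eta>. complex_of_real (F 0 \<eta>) * e \<eta>) \<in> borel_measurable lborel"
      using borel_measurable_continuous_onI by simp
  qed (simp add: norm_mult e1)
  \<comment> \<open>Only the undifferentiated integral is passed to the limit; the derivatives occur
    on bounded intervals alone.\<close>
  have "(\<lambda>m. LINT \<eta>|lborel. indicator {- R m..R m} \<eta> *\<^sub>R (complex_of_real (F 0 \<eta>) * e \<eta>)) \<longlonglongrightarrow>
      (LINT \<eta>|lborel. complex_of_real (F 0 \<eta>) * e \<eta>)"
  proof (rule integral_dominated_convergence[where w="\<lambda>\<eta>. norm (complex_of_real (F 0 \<eta>) * e \<eta>)"])
    show "AE \<eta> in lborel. (\<lambda>m. indicator {- R m..R m} \<eta> *\<^sub>R (complex_of_real (F 0 \<eta>) * e \<eta>)) \<longlonglongrightarrow> complex_of_real (F 0 \<eta>) * e \<eta>"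
    proof (intro AE_I2 tendsto_eventually)
      fix \<eta> :: real
      obtain m0 where m0: "\<bar>\<eta>\<bar> \<le> real m0" using real_arch_simple by blast
      have "\<eta> \<in> {- R m..R m}" if "m \<ge> m0" for m
      proof -
        have "\<bar>\<eta>\<bar> \<le> real m" using m0 that by linarith
        also have "\<dots> \<le> R m" using pi_gt3 mult_mono[of "real m" "2 * real m + 1" 1 pi] by (simp add: R_def)
        finally show ?thesis by auto
      qed
      then show "\<forall>\<^sub>F m in sequentially. indicator {- R m..R m} \<eta> *\<^sub>R (complex_of_real (F 0 \<eta>) * e \<eta>) = complex_of_real (F 0 \<eta>) * e \<eta>"
        by (intro eventually_sequentiallyI[of m0]) simp
    qed
  qed (use int in \<open>auto simp: indicator_def intro!: borel_measurable_scaleR\<close>)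
  moreover have "(LINT \<eta>|lborel. indicator {- R m..R m} \<eta> *\<^sub>R (complex_of_real (F 0 \<eta>) * e \<eta>)) = J 0 m" for m
  proof -
    have "set_integrable lborel {- R m..R m} (\<lambda>\<eta>. complex_of_real (F 0 \<eta>) * e \<eta>)"
      unfolding set_integrable_def by (rule integrable_mult_indicator[OF _ int]) simp
    from set_borel_integral_eq_integral(2)[OF this] show ?thesis
      by (simp add: J_def set_lebesgue_integral_def)
  qed
  ultimately have lim1: "(\<lambda>m. norm (J 0 m)) \<longlonglongrightarrow> norm (LINT \<eta>|lborel. complex_of_real (F 0 \<eta>) * e \<eta>)"
    by (intro tendsto_norm) simp
  have lim2: "(\<lambda>m. pi * D / \<bar>x\<bar> ^ n + real n * (2 * D / real (Suc m))) \<longlonglongrightarrow> pi * D / \<bar>x\<bar> ^ n + real n * 0"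
    by (intro tendsto_intros LIMSEQ_Suc[OF lim_const_over_n])
  have "norm (J 0 m) \<le> pi * D / \<bar>x\<bar> ^ n + real n * (2 * D / real (Suc m))" for m
    using iter[of n m] divide_right_mono[OF Jn[of m], of "\<bar>x\<bar> ^ n"] by simp
  then have "norm (LINT \<eta>|lborel. complex_of_real (F 0 \<eta>) * e \<eta>) \<le> pi * D / \<bar>x\<bar> ^ n + real n * 0"
    by (intro LIMSEQ_le[OF lim1 lim2]) simp
  then show ?thesis by (simp add: e_def)
qed

section \<open>The fundamental function and the interpolant\<close>

text \<open>The powers of \<bar>\<xi>\<bar> cancel. The parameter \<open>c / 2\<close> comes from
  writing the Bessel argument c\<bar>\<xi>\<bar> as 2a\<bar>\<xi>\<bar>.\<close>

lemma phi_hat_eq_mixture: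
  assumes c: "c > 0" and \<xi>: "\<xi> \<noteq> 0"
  shows "phi_hat \<alpha> c \<xi> =
    2 powr (1 + \<alpha>) / Gamma (- \<alpha>) * c powr (\<alpha> + 1/2) / 2 * mixture (c / 2) (\<alpha> + 1/2) \<xi>"
proof -
  have "c * \<bar>\<xi>\<bar> = 2 * (c / 2) * \<bar>\<xi>\<bar>" by simp
  then have b: "bessel_K (\<alpha> + 1/2) (c * \<bar>\<xi>\<bar>) = \<bar>\<xi>\<bar> powr (\<alpha> + 1/2) * mixture (c / 2) (\<alpha> + 1/2) \<xi> / 2"
    using bessel_K_eq_mixture[of "c / 2" \<xi> "\<alpha> + 1/2"] c \<xi> by simp
  have "phi_hat \<alpha> c \<xi> = 2 powr (1 + \<alpha>) / Gamma (- \<alpha>) *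
      ((c / \<bar>\<xi>\<bar>) powr (\<alpha> + 1/2) * \<bar>\<xi>\<bar> powr (\<alpha> + 1/2)) / 2 * mixture (c / 2) (\<alpha> + 1/2) \<xi>"
    unfolding phi_hat_def b by simp
  also have "(c / \<bar>\<xi>\<bar>) powr (\<alpha> + 1/2) * \<bar>\<xi>\<bar> powr (\<alpha> + 1/2) = c powr (\<alpha> + 1/2)"
    using c \<xi> by (subst powr_mult[symmetric]) auto
  finally show ?thesis .
qed

lemma notin_two_pi_latticeD: "\<xi> \<notin> two_pi_lattice \<Longrightarrow> \<xi> + 2 * pi * of_int j \<noteq> 0"
proof
  assume "\<xi> \<notin> two_pi_lattice" "\<xi> + 2 * pi * of_int j = 0"
  then have "\<xi> = 2 * pi * of_int (- j)" by simp
  with \<open>\<xi> \<notin> two_pi_lattice\<close> show False unfolding two_pi_lattice_def by blast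
qed

lemma L_hat_eq_mixture:
  assumes c: "c > 0" and \<alpha>: "\<alpha> \<notin> \<nat>" and \<xi>: "\<xi> \<notin> two_pi_lattice"
  shows "L_hat \<alpha> c \<xi> = mixture (c / 2) (\<alpha> + 1/2) \<xi> /
    (\<Sum>\<^sub>\<infinity>j\<in>(UNIV :: int set). mixture (c / 2) (\<alpha> + 1/2) (\<xi> + 2 * pi * of_int j))"
proof -
  define K where "K = 2 powr (1 + \<alpha>) / Gamma (- \<alpha>) * c powr (\<alpha> + 1/2) / 2"
  \<comment> \<open>Off its poles \<open>Gamma\<close> is nonzero; at a pole its default value 0
    would annihilate the constant and the quotient with it.\<close>
  have "- \<alpha> \<notin> \<int>\<^sub>\<le>\<^sub>0" using \<alpha> by (auto elim!: nonpos_Ints_cases')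
  then have K: "K \<noteq> 0" using c by (simp add: K_def Gamma_eq_zero_iff)
  have phi: "phi_hat \<alpha> c (\<xi> + 2 * pi * of_int j) = K * mixture (c / 2) (\<alpha> + 1/2) (\<xi> + 2 * pi * of_int j)" for j
    unfolding K_def by (rule phi_hat_eq_mixture[OF c notin_two_pi_latticeD[OF \<xi>]])
  have "L_hat \<alpha> c \<xi> = L_hat_quot \<alpha> c \<xi>"
    using \<xi> by (auto simp: L_hat_def two_pi_lattice_def)
  also have "\<dots> = K * mixture (c / 2) (\<alpha> + 1/2) \<xi> /
      (K * (\<Sum>\<^sub>\<infinity>j\<in>(UNIV :: int set). mixture (c / 2) (\<alpha> + 1/2) (\<xi> + 2 * pi * of_int j)))"
    unfolding L_hat_quot_def phi using phi[of 0] by (simp add: infsum_cmult_right')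
  finally show ?thesis using K by simp
qed

lemma infsum_shift_int:
  fixes f :: "int \<Rightarrow> real"
  shows "(\<Sum>\<^sub>\<infinity>j\<in>UNIV. f (j + i)) = (\<Sum>\<^sub>\<infinity>j\<in>UNIV. f j)"
  by (rule infsum_reindex_bij_betw) (rule bij_betwI[where g="\<lambda>j. j - i"], auto)

lemma summable_on_shift_int:
  fixes f :: "int \<Rightarrow> real"
  assumes "f summable_on UNIV"
  shows "(\<lambda>j. f (j + i)) summable_on UNIV"
  using assms by (subst summable_on_reindex_bij_betw) (rule bij_betwI[where g="\<lambda>j. j - i"], auto)

text \<open>\<bar>\<eta>\<bar> \<le> 2 pi \<bar>j\<bar> + pi \<le> 7\<bar>j\<bar> + 4, and (u + v)^2
  \<le> 2u^2 + 2v^2 turns this into 98 j^2 + 32. The lemma converts bounds indexed by windows into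
  decay in \<eta>.\<close>

lemma one_plus_square_nearest_le:
  "1 + \<eta>\<^sup>2 \<le> 98 * (1 + (real_of_int (nearest \<eta>))\<^sup>2)"
proof -
  let ?j = "real_of_int (nearest \<eta>)"
  have "\<bar>\<eta>\<bar> \<le> \<bar>2 * pi * ?j\<bar> + pi" using nearest_bound[of \<eta>] by linarith
  also have "\<bar>2 * pi * ?j\<bar> = 2 * pi * \<bar>?j\<bar>" by (simp add: abs_mult)
  also have "2 * pi * \<bar>?j\<bar> + pi \<le> 7 * \<bar>?j\<bar> + 4"
    using pi_approx(2) by (intro add_mono mult_right_mono) auto
  finally have "\<bar>\<eta>\<bar>\<^sup>2 \<le> (7 * \<bar>?j\<bar> + 4)\<^sup>2" by (intro power_mono) auto
  also have "\<dots> \<le> 2 * (7 * \<bar>?j\<bar>)\<^sup>2 + 2 * 4\<^sup>2"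
    using zero_le_power2[of "7 * \<bar>?j\<bar> - 4"] by (simp add: power2_eq_square algebra_simps)
  finally show ?thesis by (simp add: power_mult_distrib)
qed

lemma L_fund_bound:
  fixes \<alpha> c :: real
  assumes c: "c > 0" and \<alpha>: "\<alpha> \<notin> \<nat>" and n: "n \<ge> 1"
    and order: "(\<alpha> + 1/2 > 0 \<and> real n \<le> 2 * \<alpha> + 1) \<or> (\<alpha> + 1/2 < 0 \<and> real n < - 2 * \<alpha> - 1)"
  shows "continuous_on UNIV (L_fund \<alpha> c)" (is ?cont)
    and "\<exists>C\<ge>0. \<forall>x. norm (L_fund \<alpha> c x) \<le> C / (1 + \<bar>x\<bar>) ^ n" (is ?bound)
proof -
  define a where "a = c / 2"
  define \<nu> where "\<nu> = \<alpha> + 1/2"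
  have a: "a > 0" using c by (simp add: a_def)
  define w where "w = mixture a \<nu>"
  define P where "P \<xi> = (\<Sum>\<^sub>\<infinity>j\<in>(UNIV::int set). w (\<xi> + 2 * pi * of_int j))" for \<xi>
  have P_local: "P \<xi> = w \<xi> + tail_sum a \<nu> \<xi>" if "\<bar>\<xi>\<bar> < 4" for \<xi>
    unfolding P_def w_def by (rule infsum_mixture_shift[OF a that])
  have P_periodic: "P (\<xi> + 2 * pi * of_int i) = P \<xi>" for \<xi> i
    unfolding P_def using infsum_shift_int[of "\<lambda>j. w (\<xi> + 2 * pi * of_int j)" i]
    by (simp add: algebra_simps)
  have \<nu>_order: "(\<nu> > 0 \<and> real n \<le> 2 * \<nu>) \<or> (\<nu> < 0 \<and> real n < - 2 * \<nu>)"
    using order by (auto simp: \<nu>_def)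
  obtain T T0 where T: "bdd_derivs {-4<..<4} {0} n T" "bdd_derivs {-4<..<4} {0} n T0"
    "\<And>\<xi>. \<xi> \<in> {-4<..<4} - {0} \<Longrightarrow> T \<xi> = 1 / (w \<xi> + tail_sum a \<nu> \<xi>)"
    "\<And>\<xi>. \<xi> \<in> {-4<..<4} - {0} \<Longrightarrow> T0 \<xi> = w \<xi> / (w \<xi> + tail_sum a \<nu> \<xi>)"
    by (rule local_quotient[OF a \<nu>_order, folded w_def]) (rule that)
  obtain MT where MT: "MT \<ge> 0" "bounded_derivs {-4<..<4} {0} n MT T"
    using T(1) by (auto simp: bdd_derivs_def)
  obtain M0 where M0: "M0 \<ge> 0" "bounded_derivs {-4<..<4} {0} n M0 T0"
    using T(2) by (auto simp: bdd_derivs_def)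
  obtain Cw where Cw: "Cw \<ge> 0" "\<And>j::int. j \<noteq> 0 \<Longrightarrow>
      bounded_derivs {-4<..<4} {} n (Cw / (real_of_int j)\<^sup>2) (\<lambda>\<xi>. w (\<xi> + 2 * pi * of_int j))"
    using bounded_derivs_mixture_shift[OF a, of n 0 \<nu>] unfolding w_def by auto
  \<comment> \<open>The factor 2 absorbs 1 + j^2 \<le> 2 j^2 for j \<noteq> 0.\<close>
  define B where "B = M0 + 2 * (2 ^ n * (Cw * MT))"
  have B: "B \<ge> 0" using M0(1) Cw(1) MT(1) by (simp add: B_def)
  \<comment> \<open>A continuous function equal to \<open>L_hat\<close> off the lattice. At lattice
    points it takes the values of the local functions, so the limits in the definition of
    \<open>L_hat\<close> need not be computed.\<close>
  define f where "f \<eta> = (if \<eta> \<in> two_pi_lattice then (if nearest \<eta> = 0 then T0 0 else w \<eta> * T 0) else w \<eta> / P \<eta>)" for \<eta>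
  have f_local: "(if j = 0 then T0 \<xi> else w (\<xi> + 2 * pi * of_int j) * T \<xi>) = f (\<xi> + 2 * pi * of_int j)"
    if \<xi>: "\<xi> \<in> {-4<..<4}" for \<xi> j
  proof (cases "\<xi> = 0")
    case True
    have "2 * pi * of_int j \<in> two_pi_lattice" by (auto simp: two_pi_lattice_def)
    then show ?thesis using True by (simp add: f_def nearest_two_pi_lattice)
  next
    case False
    have "\<xi> + 2 * pi * of_int j \<notin> two_pi_lattice"
      by (rule shift_notin_two_pi_lattice) (use \<xi> False in auto)
    moreover have "P \<xi> = w \<xi> + tail_sum a \<nu> \<xi>" by (rule P_local) (use \<xi> in auto)
    ultimately show ?thesis
      using T(3,4)[of \<xi>] \<xi> False by (simp add: f_def P_periodic)
  qed
  have fd: "bounded_derivs {-4<..<4} {0} n (B / (1 + (real_of_int j)\<^sup>2)) (\<lambda>\<xi>. f (\<xi> + 2 * pi * of_int j))" for j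
  proof (rule bounded_derivs_cong[OF _ _ f_local])
    show "bounded_derivs {-4<..<4} {0} n (B / (1 + (real_of_int j)\<^sup>2)) (\<lambda>\<xi>. if j = 0 then T0 \<xi> else w (\<xi> + 2 * pi * of_int j) * T \<xi>)"
    proof (cases "j = 0")
      case True
      have "M0 \<le> B" using Cw(1) MT(1) by (simp add: B_def)
      from bounded_derivs_mono[OF M0(2) this] show ?thesis using True by simp
    next
      case False
      have "1 \<le> \<bar>real_of_int j\<bar>" using False by auto
      from one_le_power[OF this, of 2] have j1: "(real_of_int j)\<^sup>2 \<ge> 1" by simp
      have nn: "0 \<le> Cw / (real_of_int j)\<^sup>2" using Cw(1) by simp
      have b: "bounded_derivs {-4<..<4} {0} n (2 ^ n * (Cw / (real_of_int j)\<^sup>2 * MT)) (\<lambda>\<xi>. w (\<xi> + 2 * pi * of_int j) * T \<xi>)"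
        by (rule bounded_derivs_mult[OF nn MT(1) bounded_derivs_subset_exceptions[OF Cw(2)[OF False]] MT(2)])
      have "2 ^ n * (Cw / (real_of_int j)\<^sup>2 * MT) = 2 * (2 ^ n * (Cw * MT)) / (2 * (real_of_int j)\<^sup>2)"
        by simp
      also have "\<dots> \<le> B / (1 + (real_of_int j)\<^sup>2)"
        by (rule frac_le) (use B M0(1) j1 in \<open>auto simp: B_def\<close>)
      finally show ?thesis using bounded_derivs_mono[OF b] False by simp
    qed
  qed auto
  from bounded_derivs_glue[of n "\<lambda>j. B / (1 + (real_of_int j)\<^sup>2)" f, OF fd]
  obtain F where F: "F 0 = f" "\<And>i. i < n \<Longrightarrow> continuous_on UNIV (F i)"
    "\<And>i \<eta>. i < n \<Longrightarrow> \<eta> \<notin> two_pi_lattice \<Longrightarrow> (F i has_real_derivative F (Suc i) \<eta>) (at \<eta>)"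
    "\<And>i \<eta>. i \<le> n \<Longrightarrow> \<eta> \<notin> two_pi_lattice \<Longrightarrow> \<bar>F i \<eta>\<bar> \<le> B / (1 + (real_of_int (nearest \<eta>))\<^sup>2)"
    by auto
  define D where "D = 98 * B"
  have D: "D \<ge> 0" using B by (simp add: D_def)
  have FD: "\<bar>F i \<eta>\<bar> \<le> D / (1 + \<eta>\<^sup>2)" if "i \<le> n" "\<eta> \<notin> two_pi_lattice" for i \<eta>
  proof -
    have "B / (1 + (real_of_int (nearest \<eta>))\<^sup>2) = D / (98 * (1 + (real_of_int (nearest \<eta>))\<^sup>2))"
      by (simp only: D_def mult_divide_mult_cancel_left_if) simp
    also have "\<dots> \<le> D / (1 + \<eta>\<^sup>2)"
      by (rule divide_left_mono[OF one_plus_square_nearest_le D]) (auto intro!: mult_pos_pos add_pos_nonneg)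
    finally show ?thesis using F(4)[OF that] by linarith
  qed
  have fc: "continuous_on UNIV f" using F(1) F(2)[of 0] n by simp
  have fi: "integrable lborel f"
    by (rule integrable_quadratic_decay[OF fc, of D]) (use FD[of 0] F(1) in simp)
  let ?I = "\<lambda>x. LINT \<eta>|lborel. of_real (f \<eta>) * exp (\<i> * of_real x * complex_of_real \<eta>)"
  have L: "L_fund \<alpha> c x = 1 / (2 * pi) * ?I x" for x
  proof -
    have "(LINT \<xi>|lborel. of_real (L_hat \<alpha> c \<xi>) * exp (\<i> * of_real x * of_real \<xi>)) = ?I x"
    proof (rule integral_discrete_difference[OF countable_two_pi_lattice])
      show "of_real (L_hat \<alpha> c \<xi>) * exp (\<i> * of_real x * of_real \<xi>) = of_real (f \<xi>) * exp (\<i> * of_real x * complex_of_real \<xi>)"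
        if "\<xi> \<notin> two_pi_lattice" for \<xi>
        using L_hat_eq_mixture[OF c \<alpha> that] that by (simp add: f_def P_def w_def a_def \<nu>_def)
    qed auto
    then show ?thesis by (simp add: L_fund_def)
  qed
  have meas: "(\<lambda>\<eta>. of_real (f \<eta>) * exp (\<i> * of_real x * complex_of_real \<eta>)) \<in> borel_measurable lborel" for x
  proof -
    have "continuous_on UNIV (\<lambda>\<eta>. of_real (f \<eta>) * exp (\<i> * of_real x * complex_of_real \<eta>))"
      by (intro continuous_intros fc)
    then show ?thesis using borel_measurable_continuous_onI by simp
  qed
  have nrm: "norm (of_real (f \<eta>) * exp (\<i> * of_real x * complex_of_real \<eta>)) = \<bar>f \<eta>\<bar>" for x \<eta>
    by (simp add: norm_mult)
  have "isCont ?I x" for x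
    unfolding isCont_def
  proof (rule tendsto_at_integral_dominated[where g="\<lambda>\<eta>. \<bar>f \<eta>\<bar>"])
    show "((\<lambda>h. of_real (f t) * exp (\<i> * of_real h * complex_of_real t)) \<longlongrightarrow>
        of_real (f t) * exp (\<i> * of_real x * complex_of_real t)) (at x)" for t
      by (intro tendsto_intros)
  qed (use fi meas nrm in auto)
  then have "isCont (L_fund \<alpha> c) x" for x
    unfolding L[abs_def] by (intro continuous_intros)
  then show ?cont by (simp add: continuous_at_imp_continuous_on)
  define Z where "Z = (LINT \<eta>|lborel. \<bar>f \<eta>\<bar>)"
  have Z: "Z \<ge> 0" unfolding Z_def by (intro integral_nonneg_AE) auto
  \<comment> \<open>1 + \<bar>x\<bar> \<le> 2 max(1, \<bar>x\<bar>) accounts for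
    \<open>2 ^ n\<close>; Z covers \<bar>x\<bar> < 1, and pi D covers \<bar>x\<bar> \<ge> 1.\<close>
  define C where "C = 2 ^ n * (Z + pi * D)"
  have C: "C \<ge> 0" using Z D by (simp add: C_def)
  have "norm (L_fund \<alpha> c x) \<le> C / (1 + \<bar>x\<bar>) ^ n" for x
  proof -
    have "norm (L_fund \<alpha> c x) = norm (?I x) / (2 * pi)"
      by (simp add: L norm_mult norm_divide)
    also have "\<dots> \<le> norm (?I x) / 1"
      using pi_gt3 by (intro divide_left_mono) auto
    also have "\<dots> \<le> C / (1 + \<bar>x\<bar>) ^ n"
    proof (cases "\<bar>x\<bar> \<ge> 1")
      case True
      have "norm (?I x) \<le> pi * D / \<bar>x\<bar> ^ n"
        using fourier_integral_decay[where F=F, OF n True D F(2,3) FD] by (simp add: F(1))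
      also have "\<dots> = 2 ^ n * (pi * D) / (2 * \<bar>x\<bar>) ^ n"
        by (simp add: power_mult_distrib)
      also have "\<dots> \<le> C / (1 + \<bar>x\<bar>) ^ n"
        by (rule frac_le) (use True Z D power_mono[of "1 + \<bar>x\<bar>" "2 * \<bar>x\<bar>" n] in \<open>auto simp: C_def\<close>)
      finally show ?thesis by simp
    next
      case False
      have "norm (?I x) \<le> (LINT \<eta>|lborel. norm (of_real (f \<eta>) * exp (\<i> * of_real x * complex_of_real \<eta>)))"
        by (rule integral_norm_bound)
      also have "\<dots> = Z" by (simp only: nrm Z_def)
      also have "\<dots> = 2 ^ n * Z / 2 ^ n" by simp
      also have "\<dots> \<le> C / (1 + \<bar>x\<bar>) ^ n"
        by (rule frac_le) (use False Z D in \<open>auto simp: C_def intro!: power_mono\<close>)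
      finally show ?thesis by simp
    qed
    finally show ?thesis .
  qed
  then show ?bound using C by blast
qed

section \<open>Series of translates with growing coefficients\<close>

lemma shift_series_bounds:
  fixes L :: "real \<Rightarrow> complex" and y :: "int \<Rightarrow> complex" and A C \<epsilon> p :: real
  assumes cont: "continuous_on UNIV L" and C: "C \<ge> 0" and L: "\<And>x. norm (L x) \<le> C / (1 + \<bar>x\<bar>) ^ n"
    and n: "n \<ge> 2" and \<epsilon>: "\<epsilon> > 0" and p: "p = real n - 1 - \<epsilon>"
    and A: "A > 0" and y: "\<And>j. norm (y j) \<le> A * (1 + \<bar>real_of_int j\<bar> powr p)"
  defines "S \<equiv> \<lambda>x. \<Sum>\<^sub>\<infinity>j\<in>UNIV. y j * L (x - of_int j)"
  shows "\<And>x. (\<lambda>j. y j * L (x - of_int j)) summable_on UNIV"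
    and "continuous_on UNIV S"
    and "(\<lambda>x. norm (S x)) \<in> O[at_infinity](\<lambda>x. 1 + \<bar>x\<bar> powr p)"
proof -
  \<comment> \<open>p is negative for large \<epsilon>, whereas the product inequality may only be
    raised to a nonnegative power; hence q. The choice of s makes q - n = -s for either sign of p,
    and s > 1 because n \<ge> 2.\<close>
  define q where "q = max p 0"
  define s where "s = min (1 + \<epsilon>) (real n)"
  have q: "q \<ge> 0" and s: "s > 1" and qs: "q - real n = - s"
    using n \<epsilon> p by (auto simp: q_def s_def)
  define B where "B = 2 * A * C"
  have B: "B \<ge> 0" using A C by (simp add: B_def)
  have prod: "1 + \<bar>u + v\<bar> \<le> (1 + \<bar>u\<bar>) * (1 + \<bar>v\<bar>)" for u v :: real
  proof -
    have "(1 + \<bar>u\<bar>) * (1 + \<bar>v\<bar>) = 1 + \<bar>u\<bar> + \<bar>v\<bar> + \<bar>u\<bar> * \<bar>v\<bar>" by (simp add: algebra_simps)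
    moreover have "0 \<le> \<bar>u\<bar> * \<bar>v\<bar>" by simp
    ultimately show ?thesis using abs_triangle_ineq[of u v] by linarith
  qed
  have series_term: "norm (y j * L (x - of_int j)) \<le> B * (1 + \<bar>x\<bar>) powr q * (1 + \<bar>x - of_int j\<bar>) powr (- s)" for x j
  proof -
    have "\<bar>real_of_int j\<bar> powr p \<le> (1 + \<bar>real_of_int j\<bar>) powr q"
    \<comment> \<open>For j = 0 the left side is \<open>0 powr p\<close> = 0, also when p is
      negative.\<close>
    proof (cases "j = 0")
      case False
      then have j: "\<bar>real_of_int j\<bar> \<ge> 1" by auto
      have "\<bar>real_of_int j\<bar> powr p \<le> \<bar>real_of_int j\<bar> powr q"
        using j by (intro powr_mono) (auto simp: q_def)
      also have "\<dots> \<le> (1 + \<bar>real_of_int j\<bar>) powr q"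
        using q by (intro powr_mono2) auto
      finally show ?thesis .
    qed simp
    moreover have "1 \<le> (1 + \<bar>real_of_int j\<bar>) powr q" using q by (intro ge_one_powr_ge_zero) auto
    moreover have "(1 + \<bar>real_of_int j\<bar>) powr q \<le> ((1 + \<bar>x\<bar>) * (1 + \<bar>x - of_int j\<bar>)) powr q"
      using prod[of x "of_int j - x"] q by (intro powr_mono2) (auto simp: abs_minus_commute)
    ultimately have "1 + \<bar>real_of_int j\<bar> powr p \<le> 2 * ((1 + \<bar>x\<bar>) powr q * (1 + \<bar>x - of_int j\<bar>) powr q)"
      unfolding powr_mult by linarith
    then have "A * (1 + \<bar>real_of_int j\<bar> powr p) \<le> A * (2 * ((1 + \<bar>x\<bar>) powr q * (1 + \<bar>x - of_int j\<bar>) powr q))"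
      using A by (intro mult_left_mono) auto
    then have "norm (y j) \<le> 2 * A * ((1 + \<bar>x\<bar>) powr q * (1 + \<bar>x - of_int j\<bar>) powr q)"
      using y[of j] by (simp add: mult.assoc mult.left_commute)
    moreover have "norm (L (x - of_int j)) \<le> C * (1 + \<bar>x - of_int j\<bar>) powr (- real n)"
      using L[of "x - of_int j"] by (simp add: powr_minus_divide powr_realpow add_pos_nonneg)
    ultimately have "norm (y j) * norm (L (x - of_int j)) \<le>
        2 * A * ((1 + \<bar>x\<bar>) powr q * (1 + \<bar>x - of_int j\<bar>) powr q) * (C * (1 + \<bar>x - of_int j\<bar>) powr (- real n))"
      using A by (intro mult_mono) auto
    also have "\<dots> = B * (1 + \<bar>x\<bar>) powr q * ((1 + \<bar>x - of_int j\<bar>) powr q * (1 + \<bar>x - of_int j\<bar>) powr (- real n))"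
      by (simp add: B_def)
    also have "(1 + \<bar>x - of_int j\<bar>) powr q * (1 + \<bar>x - of_int j\<bar>) powr (- real n) = (1 + \<bar>x - of_int j\<bar>) powr (- s)"
      by (simp add: powr_add[symmetric] qs)
    finally show ?thesis by (simp add: norm_mult)
  qed
  define g where "g j = (1 + \<bar>real_of_int j\<bar>) powr (- s)" for j :: int
  have g: "g summable_on UNIV" unfolding g_def by (rule summable_on_int_powr[OF s])
  \<comment> \<open>A second use of the product inequality moves x into the constant, so one
    summable sequence dominates for all \<bar>x\<bar> \<le> r. This serves convergence and
    continuity; as a growth estimate it is too weak.\<close>
  have series_term': "norm (y j * L (x - of_int j)) \<le> B * (1 + r) powr (q + s) * g j" if "\<bar>x\<bar> \<le> r" for x j r
  proof -
    have "1 + \<bar>real_of_int j\<bar> \<le> (1 + \<bar>x\<bar>) * (1 + \<bar>x - of_int j\<bar>)"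
      using prod[of x "of_int j - x"] by (simp add: abs_minus_commute)
    then have "((1 + \<bar>x\<bar>) * (1 + \<bar>x - of_int j\<bar>)) powr (- s) \<le> g j"
      unfolding g_def using s by (intro powr_mono2') auto
    then have "(1 + \<bar>x\<bar>) powr s * ((1 + \<bar>x\<bar>) powr (- s) * (1 + \<bar>x - of_int j\<bar>) powr (- s)) \<le> (1 + \<bar>x\<bar>) powr s * g j"
      by (intro mult_left_mono) (auto simp: powr_mult)
    moreover have "(1 + \<bar>x\<bar>) powr s * (1 + \<bar>x\<bar>) powr (- s) = 1"
      by (simp add: powr_add[symmetric])
    ultimately have "(1 + \<bar>x - of_int j\<bar>) powr (- s) \<le> (1 + \<bar>x\<bar>) powr s * g j"
      by (simp add: mult.assoc[symmetric])
    then have "B * (1 + \<bar>x\<bar>) powr q * (1 + \<bar>x - of_int j\<bar>) powr (- s) \<le> B * (1 + \<bar>x\<bar>) powr q * ((1 + \<bar>x\<bar>) powr s * g j)"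
      using B by (intro mult_left_mono) auto
    also have "\<dots> = B * (1 + \<bar>x\<bar>) powr (q + s) * g j" by (simp add: powr_add)
    also have "\<dots> \<le> B * (1 + r) powr (q + s) * g j"
      using B q s that by (intro mult_right_mono mult_left_mono powr_mono2) (auto simp: g_def)
    finally show ?thesis using series_term[of j x] by linarith
  qed
  have abs_summ: "(\<lambda>j. norm (y j * L (x - of_int j))) summable_on UNIV" for x
    by (rule summable_on_comparison_test[OF summable_on_cmult_right[OF g, of "B * (1 + \<bar>x\<bar>) powr (q + s)"]])
       (use series_term'[of x "\<bar>x\<bar>"] in auto)
  show summ: "(\<lambda>j. y j * L (x - of_int j)) summable_on UNIV" for x
    by (rule abs_summable_summable[OF abs_summ])
  have S_int: "S x = (\<integral>j. y j * L (x - of_int j) \<partial>count_space UNIV)" for x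
    using abs_summ[of x] unfolding S_def
    by (subst infsetsum_infsum[symmetric]) (auto simp: infsetsum_def abs_summable_equivalent[symmetric])
  have "isCont S x" for x
    unfolding isCont_def S_int[abs_def]
  proof (rule tendsto_at_integral_dominated)
    show "integrable (count_space UNIV) (\<lambda>j. B * (1 + (\<bar>x\<bar> + 1)) powr (q + s) * g j)"
      by (intro integrable_mult_right) (use g in \<open>simp add: integrable_count_space_iff_summable_on g_def[abs_def]\<close>)
    show "\<forall>\<^sub>F h in at x. \<forall>j\<in>space (count_space UNIV). norm (y j * L (h - of_int j)) \<le> B * (1 + (\<bar>x\<bar> + 1)) powr (q + s) * g j"
      unfolding eventually_at
    proof (intro exI[of _ 1] conjI ballI impI)
      fix h j assume "h \<noteq> x \<and> dist h x < 1"
      then have "\<bar>h\<bar> \<le> \<bar>x\<bar> + 1" by (auto simp: dist_real_def)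
      then show "norm (y j * L (h - of_int j)) \<le> B * (1 + (\<bar>x\<bar> + 1)) powr (q + s) * g j"
        by (rule series_term')
    qed simp
    have Lc: "isCont L z" for z using cont by (simp add: continuous_on_eq_continuous_at)
    have "isCont (\<lambda>h. L (h - of_int j)) x" for j
      by (rule isCont_o2[OF _ Lc]) (intro continuous_intros)
    then have "isCont (\<lambda>h. y j * L (h - of_int j)) x" for j
      by (rule isCont_mult[OF continuous_const])
    then show "((\<lambda>h. y j * L (h - of_int j)) \<longlongrightarrow> y j * L (x - of_int j)) (at x)" for j
      by (simp add: isCont_def)
  qed auto
  then show "continuous_on UNIV S" by (simp add: continuous_at_imp_continuous_on)
  define Z where "Z = (\<Sum>\<^sub>\<infinity>j\<in>UNIV. g j)"
  have Z: "Z \<ge> 0" unfolding Z_def by (rule infsum_nonneg) (simp add: g_def)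
  have growth: "norm (S x) \<le> B * 2 powr s * Z * (1 + \<bar>x\<bar>) powr q" for x
  proof -
    \<comment> \<open>For the sharp growth the index is centred at the integer part of x: the sum of
      the shifted bounds no longer depends on x.\<close>
    define m where "m = \<lfloor>x\<rfloor>"
    have t2: "norm (y j * L (x - of_int j)) \<le> B * (1 + \<bar>x\<bar>) powr q * 2 powr s * g (j + - m)" for j
    proof -
      have m: "of_int m \<le> x" "x < of_int m + 1" unfolding m_def by linarith+
      have "(1 + \<bar>real_of_int (j + - m)\<bar>) / 2 \<le> 1 + \<bar>x - of_int j\<bar>"
      proof (cases "j = m")
        case False
        then have "\<bar>real_of_int (j + - m)\<bar> \<ge> 1" by auto
        then show ?thesis using m by (simp add: abs_if split: if_splits)
      qed simp
      then have "(1 + \<bar>x - of_int j\<bar>) powr (- s) \<le> ((1 + \<bar>real_of_int (j + - m)\<bar>) / 2) powr (- s)"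
        using s by (intro powr_mono2') auto
      also have "\<dots> = 2 powr s * g (j + - m)"
        by (simp add: g_def powr_divide powr_minus divide_simps)
      finally have "B * (1 + \<bar>x\<bar>) powr q * (1 + \<bar>x - of_int j\<bar>) powr (- s) \<le> B * (1 + \<bar>x\<bar>) powr q * (2 powr s * g (j + - m))"
        using B by (intro mult_left_mono) auto
      then show ?thesis using series_term[of j x] by (simp add: mult.assoc)
    qed
    have "norm (S x) \<le> (\<Sum>\<^sub>\<infinity>j\<in>UNIV. norm (y j * L (x - of_int j)))"
      unfolding S_def by (rule norm_infsum_bound[OF abs_summ])
    also have "\<dots> \<le> (\<Sum>\<^sub>\<infinity>j\<in>UNIV. B * (1 + \<bar>x\<bar>) powr q * 2 powr s * g (j + - m))"
      by (intro infsum_mono abs_summ t2 summable_on_cmult_right summable_on_shift_int g)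
    also have "\<dots> = B * (1 + \<bar>x\<bar>) powr q * 2 powr s * Z"
      unfolding Z_def by (simp only: infsum_cmult_right' infsum_shift_int)
    finally show ?thesis by (simp add: mult_ac)
  qed
  have "norm (S x) \<le> B * 2 powr s * Z * 2 powr q * (1 + \<bar>x\<bar> powr p)" if x: "\<bar>x\<bar> \<ge> 1" for x
  proof -
    have "(1 + \<bar>x\<bar>) powr q \<le> (2 * \<bar>x\<bar>) powr q" using x q by (intro powr_mono2) auto
    also have "\<dots> = 2 powr q * \<bar>x\<bar> powr q" by (simp add: powr_mult)
    also have "\<dots> \<le> 2 powr q * (1 + \<bar>x\<bar> powr p)"
      using x by (intro mult_left_mono) (auto simp: q_def max_def)
    finally have "(1 + \<bar>x\<bar>) powr q \<le> 2 powr q * (1 + \<bar>x\<bar> powr p)" .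
    then have "B * 2 powr s * Z * (1 + \<bar>x\<bar>) powr q \<le> B * 2 powr s * Z * (2 powr q * (1 + \<bar>x\<bar> powr p))"
      using B Z by (intro mult_left_mono) auto
    then show ?thesis using growth[of x] by simp
  qed
  then show "(\<lambda>x. norm (S x)) \<in> O[at_infinity](\<lambda>x. 1 + \<bar>x\<bar> powr p)"
    by (intro bigoI[where c="B * 2 powr s * Z * 2 powr q"])
       (auto simp: eventually_at_infinity intro!: exI[of _ 1])
qed

text \<open>The two parts of the theorem differ only in the choice of \<open>m\<close>, so they are
  treated together.\<close>

lemma interpolant_bounds:
  fixes \<alpha> c A \<epsilon> :: real and m :: int
  assumes "c > 0" "\<epsilon> > 0" "A > 0" "\<alpha> \<notin> \<nat>" and m: "m \<ge> 2"
    and order: "(\<alpha> + 1/2 > 0 \<and> of_int m \<le> 2 * \<alpha> + 1) \<or> (\<alpha> + 1/2 < 0 \<and> of_int m < - 2 * \<alpha> - 1)"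
    and y: "\<forall>j. norm (y j) \<le> A * (1 + \<bar>real_of_int j\<bar> powr (real_of_int m - 1 - \<epsilon>))"
  shows "(\<forall>x. (\<lambda>j. y j * L_fund \<alpha> c (x - of_int j)) summable_on UNIV) \<and>
    continuous_on UNIV (interpolant \<alpha> c y) \<and>
    (\<lambda>x. norm (interpolant \<alpha> c y x)) \<in> O[at_infinity](\<lambda>x. 1 + \<bar>x\<bar> powr (real_of_int m - 1 - \<epsilon>))"
proof -
  define n where "n = nat m"
  have n: "n \<ge> 2" "real n = of_int m" using m by (auto simp: n_def)
  have order': "(\<alpha> + 1/2 > 0 \<and> real n \<le> 2 * \<alpha> + 1) \<or> (\<alpha> + 1/2 < 0 \<and> real n < - 2 * \<alpha> - 1)"
    using order n by simp
  have n1: "n \<ge> 1" using n by simp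
  note L = L_fund_bound[OF \<open>c > 0\<close> \<open>\<alpha> \<notin> \<nat>\<close> n1 order']
  obtain C where C: "C \<ge> 0" "\<And>x. norm (L_fund \<alpha> c x) \<le> C / (1 + \<bar>x\<bar>) ^ n"
    using L(2) by blast
  have p: "real_of_int m - 1 - \<epsilon> = real n - 1 - \<epsilon>" using n by simp
  from shift_series_bounds[OF L(1) C n(1) \<open>\<epsilon> > 0\<close> p \<open>A > 0\<close> y[rule_format]]
  show ?thesis unfolding interpolant_def[abs_def] by blast
qed

theorem theorem20:
  fixes c \<epsilon> A :: real
  assumes "c > 0" and "\<epsilon> > 0" and "A > 0"
  shows "(\<forall>(\<alpha>::real) (y :: int \<Rightarrow> complex).
            \<alpha> \<ge> 1/2 \<and> \<alpha> \<notin> \<nat> \<and>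
            (\<forall>j. norm (y j) \<le>
               A * (1 + \<bar>real_of_int j\<bar> powr (real_of_int \<lfloor>2 * \<alpha> + 1\<rfloor> - 1 - \<epsilon>))) \<longrightarrow>
            (\<forall>x. (\<lambda>j. y j * L_fund \<alpha> c (x - of_int j)) summable_on UNIV) \<and>
            continuous_on UNIV (interpolant \<alpha> c y) \<and>
            (\<lambda>x. norm (interpolant \<alpha> c y x)) \<in>
              O[at_infinity](\<lambda>x. 1 + \<bar>x\<bar> powr (real_of_int \<lfloor>2 * \<alpha> + 1\<rfloor> - 1 - \<epsilon>))) \<and>
         (\<forall>(\<alpha>::real) (y :: int \<Rightarrow> complex).
            \<alpha> < - 3/2 \<and>
            (\<forall>j. norm (y j) \<le>
               A * (1 + \<bar>real_of_int j\<bar> powr (real_of_int \<lceil>2 * \<bar>\<alpha>\<bar> - 2\<rceil> - 1 - \<epsilon>))) \<longrightarrow>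
            (\<forall>x. (\<lambda>j. y j * L_fund \<alpha> c (x - of_int j)) summable_on UNIV) \<and>
            continuous_on UNIV (interpolant \<alpha> c y) \<and>
            (\<lambda>x. norm (interpolant \<alpha> c y x)) \<in>
              O[at_infinity](\<lambda>x. 1 + \<bar>x\<bar> powr (real_of_int \<lceil>2 * \<bar>\<alpha>\<bar> - 2\<rceil> - 1 - \<epsilon>)))"
proof (rule conjI; intro allI impI; elim conjE)
  fix \<alpha> :: real and y :: "int \<Rightarrow> complex"
  assume \<alpha>: "\<alpha> \<ge> 1/2" "\<alpha> \<notin> \<nat>"
    and y: "\<forall>j. norm (y j) \<le> A * (1 + \<bar>real_of_int j\<bar> powr (real_of_int \<lfloor>2 * \<alpha> + 1\<rfloor> - 1 - \<epsilon>))"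
  show "(\<forall>x. (\<lambda>j. y j * L_fund \<alpha> c (x - of_int j)) summable_on UNIV) \<and>
            continuous_on UNIV (interpolant \<alpha> c y) \<and>
            (\<lambda>x. norm (interpolant \<alpha> c y x)) \<in>
              O[at_infinity](\<lambda>x. 1 + \<bar>x\<bar> powr (real_of_int \<lfloor>2 * \<alpha> + 1\<rfloor> - 1 - \<epsilon>))"
    \<comment> \<open>\<alpha> \<ge> 1/2 is exactly the condition floor(2\<alpha> + 1) \<ge>
      2.\<close>
    by (rule interpolant_bounds[OF assms \<alpha>(2) _ _ y]) (use \<alpha>(1) in \<open>simp_all add: le_floor_iff\<close>)
next
  fix \<alpha> :: real and y :: "int \<Rightarrow> complex"
  assume \<alpha>: "\<alpha> < - 3/2"
    and y: "\<forall>j. norm (y j) \<le> A * (1 + \<bar>real_of_int j\<bar> powr (real_of_int \<lceil>2 * \<bar>\<alpha>\<bar> - 2\<rceil> - 1 - \<epsilon>))"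
  have "\<alpha> \<notin> \<nat>" using \<alpha> by (auto elim!: Nats_cases)
  \<comment> \<open>The argument of the ceiling exceeds 1. A ceiling is less than its argument plus
    1, which gives the strict upper bound after it.\<close>
  moreover have "\<lceil>2 * \<bar>\<alpha>\<bar> - 2\<rceil> \<ge> 2" using \<alpha> by (simp add: le_ceiling_iff)
  moreover have "of_int \<lceil>2 * \<bar>\<alpha>\<bar> - 2\<rceil> < - 2 * \<alpha> - 1" using \<alpha> by linarith
  ultimately show "(\<forall>x. (\<lambda>j. y j * L_fund \<alpha> c (x - of_int j)) summable_on UNIV) \<and>
            continuous_on UNIV (interpolant \<alpha> c y) \<and>
            (\<lambda>x. norm (interpolant \<alpha> c y x)) \<in>
              O[at_infinity](\<lambda>x. 1 + \<bar>x\<bar> powr (real_of_int \<lceil>2 * \<bar>\<alpha>\<bar> - 2\<rceil> - 1 - \<epsilon>))"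
    using \<alpha> by (intro interpolant_bounds[OF assms _ _ _ y]) auto
qed

end
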